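(* Let $t=m\tau$ be a discrete time with $t+\tau\le T$, let $(U(t),W(t))$ be the coefficient vectors of a solution of the fully implicit scheme at time $t$, and let $(\phi_N,\psi_N)$ be the pair of functions corresponding to the solution at time $t+\tau$ (defined in the context). Let $$D_3:=D_3(\Omega,p,T,w_0)=c_{inv}^2e^{3T\|p\|_{1,\infty}}\|w_0\|_2+2\|p\|_{1,\infty},$$ where $c_{inv}>0$ is a constant such that $|v|_{1,4}\le c_{inv}h^{-5/4}\|v\|_2$ for all $v\in X_N$. If $h<1$ and $$0<\tau\le\min\left\{\frac{1}{6\|p\|_{1,\infty}},\ \frac{h^2}{16\,c_{0,inv}\|W(t)\|_M},\ \frac{h^{5/2}}{D_3}\right\}=O(h^{2.5}),$$ then, for any choice of initial guesses $\{\phi_N^{(0)},\psi_N^{(0)}\}\subset X_{N,P}$, the Modified Newton iterates $\phi_N^{(k)},\psi_N^{(k)}$ (defined in the context) converge to the unique solution $(U(t+\tau),W(t+\tau))$ of the fully implicit scheme at time $t+\tau$, i.e. $$\lim_{k\to\infty}\phi_N^{(k)}=\phi_N\qquad\text{and}\qquad\lim_{k\to\infty}\psi_N^{(k)}=\psi_N .$$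
   Context: $\Omega=(0,L)^2$; $\langle\cdot,\cdot\rangle_2$, $\|\cdot\|_2$ are the $L^2(\Omega)$ inner product and norm; $\langle u,v\rangle_{H^1}=\langle u,v\rangle_2+\langle\nabla u,\nabla v\rangle_2$, with norm $\|\cdot\|_{H^1}$; $|v|_{1,4}=\left(\int_\Omega|\nabla v|^4\right)^{1/4}$. For a function $u$, $\vec V(u)=(-u_y,u_x)$. $p\in W^{1,\infty}(\Omega)$ is given, $\|p\|_{1,\infty}=\max\{\|p\|_{L^\infty},\|p_x\|_{L^\infty},\|p_y\|_{L^\infty}\}$ (with $1/0=+\infty$). $T>0$ is fixed. $w_0=u_0-\Delta u_0\in L^2(\Omega)$, where $u_0\in H^2(\Omega)\cap H^1_P$ is given and $H^1_P$ is the space of $H^1(\Omega)$ functions that are periodic. Finite elements: $\overline\Omega$ is covered by an $n\times n$ tensor grid of nodes and a conforming structured triangulation based on it, with mesh size $h$. $X_N$ is the space of continuous functions on $\overline\Omega$ that are affine on each triangle; $X_{N,P}\subset X_N$ is the subspace of functions satisfying periodic boundary conditions, of dimension $N=(n-1)^2$, with nodal basis $\varphi_1,\dots,\varphi_N$. $c_{0,inv}>0$ is a constant such that $\|v\|_{H^1}\le\frac{c_{0,inv}}{h}\|v\|_2$ for all $v\in X_N$. $N\times N$ matrices: $M_{I,J}=\langle\varphi_I,\varphi_J\rangle_2$, $K_{I,J}=\langle\varphi_I,\varphi_J\rangle_{H^1}$, $R_{I,J}=\langle\vec V(p)\cdot\nabla\varphi_J,\varphi_I\rangle_2$; for $U\in\mathbb{R}^N$,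 $S_{I,J}(U)=-\langle\vec V(\sum_LU_L\varphi_L)\cdot\nabla\varphi_I,\varphi_J\rangle_2$. $\|a\|_M^2=a^TMa$. Fully implicit scheme: $W(0)$ is the coefficient vector of the $L^2$ projection of $w_0$ onto $X_{N,P}$, $KU(0)=MW(0)$, and for each discrete time $t=m\tau$ with $t+\tau\le T$, $(M+\tau S(U(t+\tau)))W(t+\tau)-\tau RU(t+\tau)=MW(t)$ and $KU(s)=MW(s)$ for $s\in\{t,t+\tau\}$. It is known (earlier work) that, given $(U(t),W(t))$, this system has a unique solution $(U(t+\tau),W(t+\tau))$ when $\tau\le\min\{\frac{1}{2\|p\|_{1,\infty}},\frac{h^2}{16c_{0,inv}\|W(t)\|_M}\}$. Put $\phi_N=\sum_IU_I(t+\tau)\varphi_I$, $\psi_N=\sum_IW_I(t+\tau)\varphi_I$. Modified Newton method: starting from an initial guess $(U^{(0)},W^{(0)})\in\mathbb{R}^N\times\mathbb{R}^N$, for $k\ge0$, $(U^{(k+1)},W^{(k+1)})$ solves $$\begin{bmatrix}-\tau R&M+\tau S(U^{(k)})\\ K&-M\end{bmatrix}\begin{bmatrix}U^{(k+1)}\\ W^{(k+1)}\end{bmatrix}=\begin{bmatrix}MW(t)\\ 0\end{bmatrix}.$$ $\phi_N^{(k)}=\sum_IU^{(k)}_I\varphi_I$ and $\psi_N^{(k)}=\sum_IW^{(k)}_I\varphi_I$. *)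

theory Defs
  imports "HOL-Analysis.Analysis" "HOL-Probability.Essential_Supremum"
begin

section \<open>Function spaces on the square\<close>

definition Omega :: "real \<Rightarrow> (real \<times> real) set" where
  "Omega L = {0<..<L} \<times> {0<..<L}"

definition Omega_bar :: "real \<Rightarrow> (real \<times> real) set" where
  "Omega_bar L = {0..L} \<times> {0..L}"

text \<open>The classical gradient. It is used for smooth functions and for finite element functions;
  the latter are differentiable off the edges of the triangulation, a null set, and there the
  classical gradient is the weak one. The measure below is the completed Lebesgue measure, so the
  unspecified values on the edges do not affect any integral.\<close>

definition grad :: "(real \<times> real \<Rightarrow> real) \<Rightarrow> real \<times> real \<Rightarrow> real \<times> real" where
  "grad v z = (frechet_derivative v (at z) (1, 0), frechet_derivative v (at z) (0, 1))"

definition ip2 :: "real \<Rightarrow> (real \<times> real \<Rightarrow> real) \<Rightarrow> (real \<times> real \<Rightarrow> real) \<Rightarrow> real" where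
  "ip2 L u v = (LINT z|lebesgue_on (Omega L). u z * v z)"

definition norm2 :: "real \<Rightarrow> (real \<times> real \<Rightarrow> real) \<Rightarrow> real" where
  "norm2 L v = sqrt (ip2 L v v)"

definition ipH1 :: "real \<Rightarrow> (real \<times> real \<Rightarrow> real) \<Rightarrow> (real \<times> real \<Rightarrow> real) \<Rightarrow> real" where
  "ipH1 L u v = ip2 L u v + (LINT z|lebesgue_on (Omega L). grad u z \<bullet> grad v z)"

definition normH1 :: "real \<Rightarrow> (real \<times> real \<Rightarrow> real) \<Rightarrow> real" where
  "normH1 L v = sqrt (ipH1 L v v)"

definition seminorm14 :: "real \<Rightarrow> (real \<times> real \<Rightarrow> real) \<Rightarrow> real" where
  "seminorm14 L v = (LINT z|lebesgue_on (Omega L). norm (grad v z) ^ 4) powr (1 / 4)"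

definition in_L2 :: "real \<Rightarrow> (real \<times> real \<Rightarrow> real) \<Rightarrow> bool" where
  "in_L2 L u \<longleftrightarrow> u \<in> borel_measurable (lebesgue_on (Omega L)) \<and>
     integrable (lebesgue_on (Omega L)) (\<lambda>z. (u z)\<^sup>2)"

definition Linf_norm :: "real \<Rightarrow> (real \<times> real \<Rightarrow> real) \<Rightarrow> ereal" where
  "Linf_norm L u = esssup (lebesgue_on (Omega L)) (\<lambda>z. ereal \<bar>u z\<bar>)"

definition in_Linf :: "real \<Rightarrow> (real \<times> real \<Rightarrow> real) \<Rightarrow> bool" where
  "in_Linf L u \<longleftrightarrow> u \<in> borel_measurable (lebesgue_on (Omega L)) \<and> Linf_norm L u < \<infinity>"

text \<open>Smooth functions on the plane; \<open>D i j\<close> is the partial derivative of order \<open>i\<close> in the first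
  and \<open>j\<close> in the second variable.\<close>

definition smooth :: "(real \<times> real \<Rightarrow> real) \<Rightarrow> bool" where
  "smooth f \<longleftrightarrow> (\<exists>D :: nat \<Rightarrow> nat \<Rightarrow> real \<times> real \<Rightarrow> real. D 0 0 = f \<and>
     (\<forall>i j z. (D i j has_derivative (\<lambda>d. fst d * D (Suc i) j z + snd d * D i (Suc j) z)) (at z)))"

definition test_function :: "real \<Rightarrow> (real \<times> real \<Rightarrow> real) \<Rightarrow> bool" where
  "test_function L f \<longleftrightarrow> smooth f \<and>
     compact (closure {z. f z \<noteq> 0}) \<and> closure {z. f z \<noteq> 0} \<subseteq> Omega L"

definition loc_integrable :: "real \<Rightarrow> (real \<times> real \<Rightarrow> real) \<Rightarrow> bool" where
  "loc_integrable L u \<longleftrightarrow> (\<forall>C. compact C \<and> C \<subseteq> Omega L \<longrightarrow> set_integrable lebesgue C u)"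

text \<open>\<open>g\<close> is the weak derivative of \<open>u\<close> on \<open>Omega L\<close> in direction \<open>e\<close>.\<close>

definition weak_deriv ::
  "real \<Rightarrow> real \<times> real \<Rightarrow> (real \<times> real \<Rightarrow> real) \<Rightarrow> (real \<times> real \<Rightarrow> real) \<Rightarrow> bool" where
  "weak_deriv L e u g \<longleftrightarrow> loc_integrable L u \<and> loc_integrable L g \<and>
     (\<forall>f. test_function L f \<longrightarrow>
        (LINT z|lebesgue_on (Omega L). u z * (grad f z \<bullet> e)) =
        - (LINT z|lebesgue_on (Omega L). g z * f z))"

abbreviation weak_dx :: "real \<Rightarrow> (real \<times> real \<Rightarrow> real) \<Rightarrow> (real \<times> real \<Rightarrow> real) \<Rightarrow> bool" where
  "weak_dx L \<equiv> weak_deriv L (1, 0)"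

abbreviation weak_dy :: "real \<Rightarrow> (real \<times> real \<Rightarrow> real) \<Rightarrow> (real \<times> real \<Rightarrow> real) \<Rightarrow> bool" where
  "weak_dy L \<equiv> weak_deriv L (0, 1)"

text \<open>\<open>p\<close> lies in \<open>W\<^sup>1\<^sup>,\<^sup>\<infinity>\<close>, with weak partial derivatives \<open>px\<close> and \<open>py\<close>.\<close>

definition in_W1inf ::
  "real \<Rightarrow> (real \<times> real \<Rightarrow> real) \<Rightarrow> (real \<times> real \<Rightarrow> real) \<Rightarrow> (real \<times> real \<Rightarrow> real) \<Rightarrow> bool" where
  "in_W1inf L p px py \<longleftrightarrow> weak_dx L p px \<and> weak_dy L p py \<and>
     in_Linf L p \<and> in_Linf L px \<and> in_Linf L py"

definition norm1inf ::
  "real \<Rightarrow> (real \<times> real \<Rightarrow> real) \<Rightarrow> (real \<times> real \<Rightarrow> real) \<Rightarrow> (real \<times> real \<Rightarrow> real) \<Rightarrow> real" where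
  "norm1inf L p px py =
     real_of_ereal (max (Linf_norm L p) (max (Linf_norm L px) (Linf_norm L py)))"

definition in_H1 :: "real \<Rightarrow> (real \<times> real \<Rightarrow> real) \<Rightarrow> bool" where
  "in_H1 L u \<longleftrightarrow> in_L2 L u \<and>
     (\<exists>ux uy. weak_dx L u ux \<and> weak_dy L u uy \<and> in_L2 L ux \<and> in_L2 L uy)"

definition in_H2 :: "real \<Rightarrow> (real \<times> real \<Rightarrow> real) \<Rightarrow> bool" where
  "in_H2 L u \<longleftrightarrow> in_L2 L u \<and>
     (\<exists>ux uy. weak_dx L u ux \<and> weak_dy L u uy \<and> in_H1 L ux \<and> in_H1 L uy)"

definition weak_laplacian ::
  "real \<Rightarrow> (real \<times> real \<Rightarrow> real) \<Rightarrow> (real \<times> real \<Rightarrow> real) \<Rightarrow> bool" where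
  "weak_laplacian L u l \<longleftrightarrow>
     (\<exists>ux uy uxx uyy. weak_dx L u ux \<and> weak_dy L u uy \<and> weak_dx L ux uxx \<and> weak_dy L uy uyy \<and>
        l = (\<lambda>z. uxx z + uyy z))"

text \<open>\<open>g\<close> is the trace of the \<open>H\<^sup>1\<close> function \<open>u\<close> on the side of the square parametrised by
  \<open>\<gamma>\<close> on \<open>[0, L]\<close>: the trace operator is the continuous extension to \<open>H\<^sup>1\<close> of the restriction
  of functions that are smooth up to the boundary.\<close>

definition has_trace ::
  "real \<Rightarrow> (real \<Rightarrow> real \<times> real) \<Rightarrow> (real \<times> real \<Rightarrow> real) \<Rightarrow> (real \<Rightarrow> real) \<Rightarrow> bool" where
  "has_trace L \<gamma> u g \<longleftrightarrow> in_H1 L u \<and>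
     g \<in> borel_measurable (lebesgue_on {0..L}) \<and> integrable (lebesgue_on {0..L}) (\<lambda>s. (g s)\<^sup>2) \<and>
     (\<exists>ux uy v. weak_dx L u ux \<and> weak_dy L u uy \<and> (\<forall>k::nat. smooth (v k)) \<and>
        (\<lambda>k. norm2 L (\<lambda>z. v k z - u z)) \<longlonglongrightarrow> 0 \<and>
        (\<lambda>k. norm2 L (\<lambda>z. fst (grad (v k) z) - ux z)) \<longlonglongrightarrow> 0 \<and>
        (\<lambda>k. norm2 L (\<lambda>z. snd (grad (v k) z) - uy z)) \<longlonglongrightarrow> 0 \<and>
        (\<lambda>k. LINT s|lebesgue_on {0..L}. (v k (\<gamma> s) - g s)\<^sup>2) \<longlonglongrightarrow> 0)"

definition in_H1P :: "real \<Rightarrow> (real \<times> real \<Rightarrow> real) \<Rightarrow> bool" where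
  "in_H1P L u \<longleftrightarrow> in_H1 L u \<and>
     (\<exists>g. has_trace L (\<lambda>s. (0, s)) u g \<and> has_trace L (\<lambda>s. (L, s)) u g) \<and>
     (\<exists>g. has_trace L (\<lambda>s. (s, 0)) u g \<and> has_trace L (\<lambda>s. (s, L)) u g)"


section \<open>Finite elements\<close>

text \<open>One coordinate of the tensor grid: \<open>n\<close> nodes \<open>xs 0, \<dots>, xs (n - 1)\<close>, not necessarily
  equidistant.\<close>

definition grid :: "real \<Rightarrow> nat \<Rightarrow> (nat \<Rightarrow> real) \<Rightarrow> bool" where
  "grid L n xs \<longleftrightarrow> 2 \<le> n \<and> strict_mono_on {..<n} xs \<and> xs 0 = 0 \<and> xs (n - 1) = L"

text \<open>Each grid cell is cut by one of its diagonals; \<open>d i j\<close> says which. Every choice of \<open>d\<close> gives a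
  conforming triangulation, and constant \<open>d\<close> gives the uniformly oriented ones.\<close>

definition cell_triangles ::
  "(nat \<Rightarrow> real) \<Rightarrow> (nat \<Rightarrow> real) \<Rightarrow> (nat \<Rightarrow> nat \<Rightarrow> bool) \<Rightarrow> nat \<Rightarrow> nat \<Rightarrow> (real \<times> real) set set" where
  "cell_triangles xs ys d i j =
    (let sw = (xs i, ys j); se = (xs (Suc i), ys j);
         nw = (xs i, ys (Suc j)); ne = (xs (Suc i), ys (Suc j))
     in if d i j then {convex hull {sw, se, ne}, convex hull {sw, ne, nw}}
        else {convex hull {sw, se, nw}, convex hull {se, ne, nw}})"

definition triangles ::
  "nat \<Rightarrow> (nat \<Rightarrow> real) \<Rightarrow> (nat \<Rightarrow> real) \<Rightarrow> (nat \<Rightarrow> nat \<Rightarrow> bool) \<Rightarrow> (real \<times> real) set set" where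
  "triangles n xs ys d = (\<Union>i<n - 1. \<Union>j<n - 1. cell_triangles xs ys d i j)"

definition mesh_size :: "(real \<times> real) set set \<Rightarrow> real" where
  "mesh_size \<T> = Max (diameter ` \<T>)"

text \<open>Functions on the closed square are represented by total functions vanishing elsewhere.\<close>

definition X_N :: "real \<Rightarrow> (real \<times> real) set set \<Rightarrow> (real \<times> real \<Rightarrow> real) set" where
  "X_N L \<T> = {v. continuous_on (Omega_bar L) v \<and>
     (\<forall>T\<in>\<T>. \<exists>a b. \<forall>z\<in>T. v z = a + b \<bullet> z) \<and> (\<forall>z. z \<notin> Omega_bar L \<longrightarrow> v z = 0)}"

definition X_NP :: "real \<Rightarrow> (real \<times> real) set set \<Rightarrow> (real \<times> real \<Rightarrow> real) set" where
  "X_NP L \<T> = {v \<in> X_N L \<T>. \<forall>s\<in>{0..L}. v (0, s) = v (L, s) \<and> v (s, 0) = v (s, L)}"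

text \<open>The index type \<open>'n\<close> enumerates, through \<open>node\<close>, the grid points that remain after
  identification of opposite sides; hence it has \<open>(n - 1)\<^sup>2\<close> elements.\<close>

definition nodal_basis ::
  "real \<Rightarrow> nat \<Rightarrow> (nat \<Rightarrow> real) \<Rightarrow> (nat \<Rightarrow> real) \<Rightarrow> (nat \<Rightarrow> nat \<Rightarrow> bool) \<Rightarrow>
    ('n::finite \<Rightarrow> nat \<times> nat) \<Rightarrow> ('n \<Rightarrow> real \<times> real \<Rightarrow> real) \<Rightarrow> bool" where
  "nodal_basis L n xs ys d node \<phi> \<longleftrightarrow>
     bij_betw node UNIV ({..<n - 1} \<times> {..<n - 1}) \<and>
     (\<forall>I. \<phi> I \<in> X_NP L (triangles n xs ys d)) \<and>
     (\<forall>I J. \<phi> I (xs (fst (node J)), ys (snd (node J))) = (if I = J then 1 else 0))"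

definition fe :: "('n::finite \<Rightarrow> real \<times> real \<Rightarrow> real) \<Rightarrow> real^'n \<Rightarrow> real \<times> real \<Rightarrow> real" where
  "fe \<phi> U = (\<lambda>z. \<Sum>I\<in>UNIV. U $ I * \<phi> I z)"

definition L2_projection ::
  "real \<Rightarrow> (real \<times> real \<Rightarrow> real) set \<Rightarrow> (real \<times> real \<Rightarrow> real) \<Rightarrow> (real \<times> real \<Rightarrow> real) \<Rightarrow> bool" where
  "L2_projection L X w v \<longleftrightarrow> v \<in> X \<and> (\<forall>f\<in>X. ip2 L (\<lambda>z. w z - v z) f = 0)"

definition matM :: "real \<Rightarrow> ('n::finite \<Rightarrow> real \<times> real \<Rightarrow> real) \<Rightarrow> real^'n^'n" where
  "matM L \<phi> = (\<chi> I J. ip2 L (\<phi> I) (\<phi> J))"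

definition matK :: "real \<Rightarrow> ('n::finite \<Rightarrow> real \<times> real \<Rightarrow> real) \<Rightarrow> real^'n^'n" where
  "matK L \<phi> = (\<chi> I J. ipH1 L (\<phi> I) (\<phi> J))"

text \<open>The vector \<open>V(u) = (- u\<^sub>y, u\<^sub>x)\<close> in terms of the gradient of \<open>u\<close>.\<close>

definition rot :: "real \<times> real \<Rightarrow> real \<times> real" where
  "rot g = (- snd g, fst g)"

definition matR ::
  "real \<Rightarrow> ('n::finite \<Rightarrow> real \<times> real \<Rightarrow> real) \<Rightarrow> (real \<times> real \<Rightarrow> real) \<Rightarrow> (real \<times> real \<Rightarrow> real) \<Rightarrow>
    real^'n^'n" where
  "matR L \<phi> px py = (\<chi> I J. ip2 L (\<lambda>z. rot (px z, py z) \<bullet> grad (\<phi> J) z) (\<phi> I))"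

definition matS :: "real \<Rightarrow> ('n::finite \<Rightarrow> real \<times> real \<Rightarrow> real) \<Rightarrow> real^'n \<Rightarrow> real^'n^'n" where
  "matS L \<phi> U = (\<chi> I J. - ip2 L (\<lambda>z. rot (grad (fe \<phi> U) z) \<bullet> grad (\<phi> I) z) (\<phi> J))"

definition normM :: "real \<Rightarrow> ('n::finite \<Rightarrow> real \<times> real \<Rightarrow> real) \<Rightarrow> real^'n \<Rightarrow> real" where
  "normM L \<phi> a = sqrt (a \<bullet> (matM L \<phi> *v a))"


section \<open>The fully implicit scheme and the modified Newton method\<close>

text \<open>One time step, from \<open>(U, W)\<close> at time \<open>t\<close> to \<open>(U', W')\<close> at time \<open>t + \<tau>\<close>.\<close>

definition implicit_step ::
  "real \<Rightarrow> ('n::finite \<Rightarrow> real \<times> real \<Rightarrow> real) \<Rightarrow> (real \<times> real \<Rightarrow> real) \<Rightarrow> (real \<times> real \<Rightarrow> real) \<Rightarrow>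
    real \<Rightarrow> real^'n \<Rightarrow> real^'n \<Rightarrow> real^'n \<Rightarrow> real^'n \<Rightarrow> bool" where
  "implicit_step L \<phi> px py \<tau> U W U' W' \<longleftrightarrow>
     (matM L \<phi> + \<tau> *\<^sub>R matS L \<phi> U') *v W' - \<tau> *\<^sub>R (matR L \<phi> px py *v U') = matM L \<phi> *v W \<and>
     matK L \<phi> *v U = matM L \<phi> *v W \<and>
     matK L \<phi> *v U' = matM L \<phi> *v W'"

text \<open>\<open>U j\<close> and \<open>W j\<close>, for \<open>j \<le> m\<close>, are the coefficient vectors at time \<open>j * \<tau>\<close>.\<close>

definition implicit_solution ::
  "real \<Rightarrow> ('n::finite \<Rightarrow> real \<times> real \<Rightarrow> real) \<Rightarrow> (real \<times> real \<Rightarrow> real) set \<Rightarrow>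
    (real \<times> real \<Rightarrow> real) \<Rightarrow> (real \<times> real \<Rightarrow> real) \<Rightarrow> (real \<times> real \<Rightarrow> real) \<Rightarrow>
    real \<Rightarrow> nat \<Rightarrow> (nat \<Rightarrow> real^'n) \<Rightarrow> (nat \<Rightarrow> real^'n) \<Rightarrow> bool" where
  "implicit_solution L \<phi> X px py w0 \<tau> m U W \<longleftrightarrow>
     L2_projection L X w0 (fe \<phi> (W 0)) \<and>
     matK L \<phi> *v U 0 = matM L \<phi> *v W 0 \<and>
     (\<forall>j<m. implicit_step L \<phi> px py \<tau> (U j) (W j) (U (Suc j)) (W (Suc j)))"

definition newton_iterates ::
  "real \<Rightarrow> ('n::finite \<Rightarrow> real \<times> real \<Rightarrow> real) \<Rightarrow> (real \<times> real \<Rightarrow> real) \<Rightarrow> (real \<times> real \<Rightarrow> real) \<Rightarrow>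
    real \<Rightarrow> real^'n \<Rightarrow> (nat \<Rightarrow> real^'n) \<Rightarrow> (nat \<Rightarrow> real^'n) \<Rightarrow> bool" where
  "newton_iterates L \<phi> px py \<tau> Wt Uk Wk \<longleftrightarrow> (\<forall>k.
     (- \<tau>) *\<^sub>R (matR L \<phi> px py *v Uk (Suc k)) +
       (matM L \<phi> + \<tau> *\<^sub>R matS L \<phi> (Uk k)) *v Wk (Suc k) = matM L \<phi> *v Wt \<and>
     matK L \<phi> *v Uk (Suc k) - matM L \<phi> *v Wk (Suc k) = 0)"

definition D3 :: "real \<Rightarrow> real \<Rightarrow> real \<Rightarrow> real \<Rightarrow> real" where
  "D3 cinv T p_norm w0_norm = cinv\<^sup>2 * exp (3 * T * p_norm) * w0_norm + 2 * p_norm"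

text \<open>The time step bound, in the extended reals, where a positive number divided by 0 is
  \<open>\<infinity>\<close>.\<close>

definition tau_bound :: "real \<Rightarrow> real \<Rightarrow> real \<Rightarrow> real \<Rightarrow> real \<Rightarrow> ereal" where
  "tau_bound h c0inv p_norm Wt_norm D =
     min (1 / ereal (6 * p_norm))
       (min (ereal (h\<^sup>2) / ereal (16 * c0inv * Wt_norm)) (ereal (h powr (5 / 2)) / ereal D))"

end

theory Submission
  imports Defs
begin

text \<open>Testing a modified Newton step with its own vorticity removes the advection term, because
  \<open>S(U)\<close> is skew, and the elliptic equation gives \<open>2 \<parallel>\<nabla>\<phi>\<parallel> \<le> \<parallel>\<psi>\<parallel>\<close>; so all iterates and all time
  steps are bounded by \<open>exp (3 T P) \<parallel>w\<^sub>0\<parallel>\<close>, where \<open>P\<close> is the norm of \<open>p\<close>. Subtracting two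
  Newton steps leaves only the advection of the second vorticity by the difference of the old
  streams. By Hoelder's inequality, the inverse inequality and the bound on \<open>\<tau>\<close>, the Newton map is
  then nonexpansive, hence continuous, and Brouwer's theorem gives a fixed point, which is a
  solution of the implicit scheme. The errors relative to it decrease, and they converge to zero
  because the gradients of the stream errors must vanish in the limit. Uniqueness is the
  convergence of the constant Newton sequence.

  Skewness of \<open>S(U)\<close> means that \<open>V(u) \<cdot> \<nabla>(a\<^sup>2 / 2)\<close> has integral zero for periodic finite element
  functions \<open>u\<close> and \<open>a\<close>: on each triangle the integral is exactly a sum of edge terms, which are
  antisymmetric in the orientation of the edge, and the sum over the periodic grid telescopes.\<close>

section \<open>Modified Newton iterations in finite dimension\<close>

text \<open>Evaluation at the minimiser \<open>- b / a\<close>; for \<open>a = 0\<close> a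
  nonnegative affine function must be constant. This is the common core of the Cauchy-Schwarz
  inequalities for the mass matrix and for integrals.\<close>

lemma quadratic_nonneg_discriminant:
  fixes a b c :: real
  assumes "\<And>t. 0 \<le> a * t\<^sup>2 + 2 * b * t + c" and "0 \<le> a"
  shows "b\<^sup>2 \<le> a * c"
proof (cases "a = 0")
  case False
  have "0 \<le> a * (- b / a)\<^sup>2 + 2 * b * (- b / a) + c" by (rule assms)
  also have "\<dots> = c - b\<^sup>2 / a" using False by (simp add: power2_eq_square field_simps)
  finally show ?thesis using False assms(2) by (simp add: field_simps)
next
  case True
  have "b = 0"
  proof (rule ccontr)
    assume "b \<noteq> 0"
    then show False using assms(1)[of "- (c + 1) / (2 * b)"] True by simp
  qed
  then show ?thesis using True by simp
qed

text \<open>\<open>gr a\<close> stands for the L2 norm of the gradient of the function with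
  coefficients \<open>a\<close>. The factor 2 in \<open>R_bound\<close> matches the elliptic
  estimate \<open>2 * gr u \<le> nM w\<close>, so that the transport term costs at most
  \<open>P\<close> times the squared mass norm.\<close>

locale implicit_scheme =
  fixes M K R :: "real^'n::finite^'n" and S :: "real^'n \<Rightarrow> real^'n^'n"
    and gr :: "real^'n \<Rightarrow> real" and \<tau> P :: real
  assumes M_sym: "\<And>a b. a \<bullet> (M *v b) = b \<bullet> (M *v a)"
    and M_pos: "\<And>a. a \<noteq> 0 \<Longrightarrow> 0 < a \<bullet> (M *v a)"
    and gr_nonneg: "\<And>a. 0 \<le> gr a"
    and K_energy: "\<And>a. a \<bullet> (K *v a) = a \<bullet> (M *v a) + (gr a)\<^sup>2"
    and S_diff: "\<And>u v. S (u - v) = S u - S v"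
    and S_skew: "\<And>u a. a \<bullet> (S u *v a) = 0"
    and R_bound: "\<And>u a. \<bar>a \<bullet> (R *v u)\<bar> \<le> 2 * P * gr u * sqrt (a \<bullet> (M *v a))"
    and P_nonneg: "0 \<le> P" and tau_pos: "0 < \<tau>"
    and tau_P: "6 * \<tau> * P \<le> 1"
begin

section \<open>The mass norm and energy estimates for one step\<close>

definition nM :: "real^'n \<Rightarrow> real" where "nM a = sqrt (a \<bullet> (M *v a))"

lemma nM_0 [simp]: "nM 0 = 0"
  by (simp add: nM_def)

lemma nM_nonneg [simp]: "0 \<le> nM a"
  using M_pos[of a] by (cases "a = 0") (auto simp: nM_def intro: less_imp_le)

lemma nM_square: "(nM a)\<^sup>2 = a \<bullet> (M *v a)"
  using M_pos[of a] by (cases "a = 0") (auto simp: nM_def intro: less_imp_le)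

lemma nM_Cauchy_Schwarz: "\<bar>a \<bullet> (M *v b)\<bar> \<le> nM a * nM b"
proof -
  have "0 \<le> (nM a)\<^sup>2 * t\<^sup>2 + 2 * (a \<bullet> (M *v b)) * t + (nM b)\<^sup>2" for t
  proof -
    have "0 \<le> (t *\<^sub>R a + b) \<bullet> (M *v (t *\<^sub>R a + b))"
      using nM_square[of "t *\<^sub>R a + b"] by (metis zero_le_power2)
    also have "\<dots> = (nM a)\<^sup>2 * t\<^sup>2 + 2 * (a \<bullet> (M *v b)) * t + (nM b)\<^sup>2"
      using M_sym[of a b] unfolding nM_square by (simp add: inner_simps power2_eq_square algebra_simps)
    finally show ?thesis .
  qed
  then have "(a \<bullet> (M *v b))\<^sup>2 \<le> (nM a)\<^sup>2 * (nM b)\<^sup>2"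
    by (rule quadratic_nonneg_discriminant) simp
  then show ?thesis
    by (metis abs_le_square_iff abs_of_nonneg mult_nonneg_nonneg nM_nonneg power_mult_distrib)
qed

lemma continuous_nM: "continuous_on A nM"
  unfolding nM_def by (intro continuous_intros matrix_vector_mul_linear linear_continuous_on
      linear_conv_bounded_linear[THEN iffD1])

text \<open>Equivalence of norms in finite dimension: \<open>nM\<close> attains a positive minimum
  on the compact unit sphere.\<close>

lemma norm_le_nM: obtains c where "0 < c" "\<And>a. norm a \<le> c * nM a"
proof -
  let ?S = "sphere (0::real^'n) 1"
  have "?S \<noteq> {}" by simp
  then obtain x where x: "x \<in> ?S" "\<And>y. y \<in> ?S \<Longrightarrow> nM x \<le> nM y"
    using continuous_attains_inf[OF compact_sphere _ continuous_nM] by metis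
  then have "x \<noteq> 0" by auto
  then have "0 < nM x" using M_pos[of x] by (simp add: nM_def)
  moreover have "norm a \<le> (1 / nM x) * nM a" for a
  proof (cases "a = 0")
    case False
    have "nM x \<le> nM ((1 / norm a) *\<^sub>R a)" using False by (intro x) simp
    also have "\<dots> = nM a / norm a"
      unfolding nM_def
      by (simp add: matrix_vector_mult_scaleR real_sqrt_divide flip: power2_eq_square)
    finally show ?thesis using False \<open>0 < nM x\<close> by (simp add: field_simps)
  qed simp
  ultimately show ?thesis using that[of "1 / nM x"] by simp
qed

text \<open>Testing the equation with \<open>u\<close> bounds the sum of the squares of
  \<open>nM u\<close> and \<open>gr u\<close> by \<open>nM u * nM w\<close>. The second bound
  measures the gradient by the gap between the two norms, which drives the convergence proof; the
  third follows from it by completing a square.\<close>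

lemma elliptic:
  assumes "K *v u = M *v w"
  shows "nM u \<le> nM w" and "(gr u)\<^sup>2 \<le> nM u * (nM w - nM u)" and "2 * gr u \<le> nM w"
proof -
  have "(nM u)\<^sup>2 + (gr u)\<^sup>2 = u \<bullet> (M *v w)"
    using K_energy[of u] assms by (simp add: nM_square)
  also have "\<dots> \<le> nM u * nM w" using nM_Cauchy_Schwarz[of u w] by simp
  finally show g: "(gr u)\<^sup>2 \<le> nM u * (nM w - nM u)" by (simp add: power2_eq_square algebra_simps)
  show "nM u \<le> nM w"
  proof (rule ccontr)
    assume "\<not> nM u \<le> nM w"
    then have "nM u * (nM w - nM u) < 0"
      by (smt (verit) mult_pos_neg nM_nonneg)
    then show False using g by (smt (verit) zero_le_power2)
  qed
  have "(2 * gr u)\<^sup>2 \<le> (nM w)\<^sup>2"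
    using g sum_squares_ge_zero[of "nM w - 2 * nM u" 0] by (simp add: power2_eq_square algebra_simps)
  then show "2 * gr u \<le> nM w" by (rule power2_le_imp_le) simp
qed

lemma R_energy:
  assumes "K *v u = M *v w"
  shows "\<bar>w \<bullet> (R *v u)\<bar> \<le> P * (nM w)\<^sup>2"
proof -
  have "\<bar>w \<bullet> (R *v u)\<bar> \<le> P * nM w * (2 * gr u)"
    using R_bound[of w u] by (simp add: nM_def algebra_simps)
  also have "\<dots> \<le> P * nM w * nM w"
    by (intro mult_left_mono elliptic[OF assms]) (simp add: P_nonneg)
  finally show ?thesis by (simp add: power2_eq_square mult.assoc)
qed

text \<open>Advection is frozen at the stream \<open>u\<close>, and \<open>b\<close> is the old
  vorticity. A Newton step takes the previous iterate for \<open>u\<close>; the implicit scheme is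
  the case \<open>u = U\<close>.\<close>

definition step :: "real^'n \<Rightarrow> real^'n \<Rightarrow> real^'n \<Rightarrow> real^'n \<Rightarrow> bool" where
  "step b u U W \<longleftrightarrow> M *v W + \<tau> *\<^sub>R (S u *v W) - \<tau> *\<^sub>R (R *v U) = M *v b \<and> K *v U = M *v W"

text \<open>Testing with \<open>W\<close> removes the advection whatever \<open>u\<close> is, and
  \<open>R_energy\<close> absorbs the transport term. Hence the bound is uniform over all frozen
  streams.\<close>

lemma step_stable:
  assumes "step b u U W"
  shows "(1 - \<tau> * P) * nM W \<le> nM b"
proof (cases "nM W = 0")
  case False
  have "W \<bullet> (M *v W + \<tau> *\<^sub>R (S u *v W) - \<tau> *\<^sub>R (R *v U)) = W \<bullet> (M *v b)"
    using assms by (simp add: step_def)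
  then have "(nM W)\<^sup>2 - \<tau> * (W \<bullet> (R *v U)) = W \<bullet> (M *v b)"
    by (simp add: inner_add_right inner_diff_right S_skew nM_square)
  moreover have "\<tau> * (W \<bullet> (R *v U)) \<le> \<tau> * (P * (nM W)\<^sup>2)"
    using R_energy[of U W] assms tau_pos by (intro mult_left_mono) (auto simp: step_def)
  ultimately have "nM W * ((1 - \<tau> * P) * nM W) \<le> nM W * nM b"
    using nM_Cauchy_Schwarz[of W b] by (simp add: power2_eq_square algebra_simps)
  then show ?thesis using False by (simp add: less_le)
qed simp

lemma tau_P_less: "0 < 1 - \<tau> * P"
  using tau_P by linarith

lemma K_inj: "K *v a = 0 \<Longrightarrow> a = 0"
proof (rule ccontr)
  assume "K *v a = 0" "a \<noteq> 0"
  then show False using K_energy[of a] M_pos[of a] zero_le_power2[of "gr a"] by (simp del: zero_le_power2)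
qed

text \<open>The elliptic equation is solved for \<open>U\<close>, which leaves the square system
  with matrix \<open>N\<close> (a Schur complement) for \<open>W\<close>. Stability with zero data
  makes \<open>N\<close> injective, hence invertible.\<close>

lemma step_ex1: "\<exists>!UW. step b u (fst UW) (snd UW)"
proof -
  obtain Ki where Ki: "Ki ** K = mat 1" "K ** Ki = mat 1"
    using K_inj matrix_left_invertible_ker matrix_left_right_inverse by metis
  define N where "N = M + \<tau> *\<^sub>R S u - \<tau> *\<^sub>R (R ** (Ki ** M))"
  have Ki': "K *v U = M *v W \<longleftrightarrow> U = Ki *v (M *v W)" for U W
    using Ki by (metis matrix_vector_mul_assoc matrix_vector_mul_lid)
  have N: "N *v W = M *v W + \<tau> *\<^sub>R (S u *v W) - \<tau> *\<^sub>R (R *v (Ki *v (M *v W)))" for W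
    unfolding N_def
    by (simp add: matrix_vector_mult_add_rdistrib matrix_vector_mult_diff_rdistrib
        scaleR_matrix_vector_assoc matrix_vector_mul_assoc matrix_mul_assoc)
  have step_N: "step b u U W \<longleftrightarrow> N *v W = M *v b \<and> U = Ki *v (M *v W)" for b U W
    unfolding step_def Ki' N by auto
  have "W = 0" if "N *v W = 0" for W
  proof -
    have "step 0 u (Ki *v (M *v W)) W" using that by (simp add: step_N)
    then have "nM W \<le> 0"
      using step_stable[of 0 u _ W] tau_P_less by (simp add: mult_le_0_iff)
    then show ?thesis using M_pos[of W] by (auto simp: nM_def not_less)
  qed
  then obtain Ni where "Ni ** N = mat 1" "N ** Ni = mat 1"
    using matrix_left_invertible_ker matrix_left_right_inverse by metis
  then have "N *v W = c \<longleftrightarrow> W = Ni *v c" for W c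
    by (metis matrix_vector_mul_assoc matrix_vector_mul_lid)
  then have "step b u (fst UW) (snd UW) \<longleftrightarrow> UW = (Ki *v (M *v (Ni *v (M *v b))), Ni *v (M *v b))" for UW
    unfolding step_N by (cases UW) auto
  then show ?thesis by simp
qed

text \<open>Since \<open>S\<close> is skew, testing the difference of two Newton steps with the difference of the
  vorticities leaves only the terms in which \<open>S\<close> is evaluated at the difference of the old streams.\<close>

lemma step_diff:
  assumes "step Wt u U W" and "step Wt v X Y"
  shows "(nM (W - Y))\<^sup>2 = \<tau> * ((W - Y) \<bullet> (R *v (U - X))) - \<tau> * ((W - Y) \<bullet> (S (u - v) *v Y))"
    and "K *v (U - X) = M *v (W - Y)"
proof -
  have "M *v (W - Y) + \<tau> *\<^sub>R (S u *v (W - Y)) + \<tau> *\<^sub>R (S (u - v) *v Y) - \<tau> *\<^sub>R (R *v (U - X)) = 0"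
    using assms
    by (simp add: step_def S_diff matrix_vector_mult_diff_distrib matrix_vector_mult_diff_rdistrib algebra_simps)
  then have "(W - Y) \<bullet> (M *v (W - Y) + \<tau> *\<^sub>R (S u *v (W - Y)) + \<tau> *\<^sub>R (S (u - v) *v Y)
      - \<tau> *\<^sub>R (R *v (U - X))) = 0"
    by simp
  then show "(nM (W - Y))\<^sup>2 = \<tau> * ((W - Y) \<bullet> (R *v (U - X))) - \<tau> * ((W - Y) \<bullet> (S (u - v) *v Y))"
    unfolding inner_add_right inner_diff_right[of "W - Y" _ "\<tau> *\<^sub>R (R *v (U - X))"] inner_scaleR_right S_skew
    by (simp add: nM_square)
  show "K *v (U - X) = M *v (W - Y)"
    using assms by (simp add: step_def matrix_vector_mult_diff_distrib)
qed

end

text \<open>\<open>B\<close> is to bound all vorticities; the factor \<open>1 - \<tau> * P\<close>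
  in \<open>Wt_bound\<close> reserves the growth of the coming step. \<open>S_bound\<close> is the
  quantitative estimate that limits \<open>\<tau>\<close>, while \<open>S_bound_gr\<close> controls
  the advection by the gradient of the stream, with a constant of any size.\<close>

locale newton_scheme = implicit_scheme M K R S gr \<tau> P
  for M K R :: "real^'n::finite^'n" and S :: "real^'n \<Rightarrow> real^'n^'n" and gr :: "real^'n \<Rightarrow> real" and \<tau> P :: real +
  fixes B \<beta> C :: real and Wt :: "real^'n"
  assumes S_bound: "\<And>u a w. \<bar>a \<bullet> (S u *v w)\<bar> \<le>
      \<beta> * sqrt (u \<bullet> (M *v u)) * sqrt (a \<bullet> (M *v a)) * sqrt (w \<bullet> (M *v w))"
    and S_bound_gr: "\<And>u a w. \<bar>a \<bullet> (S u *v w)\<bar> \<le> C * gr u * norm a * norm w"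
    and \<beta>_nonneg: "0 \<le> \<beta>" and C_nonneg: "0 \<le> C"
    and tau_B: "\<tau> * (\<beta> * B + 2 * P) \<le> 1"
    and Wt_bound: "sqrt (Wt \<bullet> (M *v Wt)) \<le> (1 - \<tau> * P) * B"
begin

section \<open>Nonexpansive Newton map, fixed point and convergence\<close>

lemmas nonneg = P_nonneg \<beta>_nonneg C_nonneg tau_pos

lemma step_bound:
  assumes "step Wt u U W"
  shows "nM W \<le> B"
proof -
  have "(1 - \<tau> * P) * nM W \<le> (1 - \<tau> * P) * B"
    using step_stable[OF assms] Wt_bound by (simp add: nM_def)
  then show ?thesis using tau_P_less by simp
qed

lemma B_nonneg: "0 \<le> B"
proof -
  have "0 \<le> (1 - \<tau> * P) * B" using Wt_bound nM_nonneg[of Wt, unfolded nM_def] by (rule order_trans[rotated])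
  then show ?thesis using tau_P_less by (simp add: zero_le_mult_iff)
qed

text \<open>In the energy identity for the difference, the transport term uses up the share
  \<open>\<tau> * P\<close> of the left side, and the advection term is at most
  \<open>\<tau> * \<beta> * B\<close> times the product of old and new error. Then
  \<open>tau_B\<close> gives \<open>\<tau> * (\<beta> * B) \<le> 1 - \<tau> * P\<close>.\<close>

lemma step_nonexpansive:
  assumes "step Wt u U W" and "step Wt v X Y"
  shows "nM (W - Y) \<le> nM (u - v)"
proof (cases "nM (W - Y) = 0")
  case False
  let ?e = "nM (W - Y)" and ?d = "nM (u - v)"
  have "\<tau> * ((W - Y) \<bullet> (R *v (U - X))) \<le> \<tau> * (P * ?e\<^sup>2)"
    using R_energy[OF step_diff(2)[OF assms]] nonneg by (intro mult_left_mono) auto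
  moreover have "- (\<tau> * ((W - Y) \<bullet> (S (u - v) *v Y))) \<le> \<tau> * (\<beta> * ?d * ?e * B)"
  proof -
    have "- ((W - Y) \<bullet> (S (u - v) *v Y)) \<le> \<beta> * ?d * ?e * nM Y"
      using S_bound[of "W - Y" "u - v" Y] by (simp add: nM_def)
    also have "\<dots> \<le> \<beta> * ?d * ?e * B"
      by (intro mult_left_mono step_bound[OF assms(2)]) (simp add: nonneg)
    finally have "\<tau> * - ((W - Y) \<bullet> (S (u - v) *v Y)) \<le> \<tau> * (\<beta> * ?d * ?e * B)"
      using nonneg(4) by (intro mult_left_mono) auto
    then show ?thesis by simp
  qed
  ultimately have "?e\<^sup>2 \<le> \<tau> * (P * ?e\<^sup>2) + \<tau> * (\<beta> * ?d * ?e * B)"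
    using step_diff(1)[OF assms] by linarith
  then have "?e * ((1 - \<tau> * P) * ?e) \<le> ?e * (\<tau> * (\<beta> * B) * ?d)"
    by (simp add: power2_eq_square algebra_simps)
  then have "(1 - \<tau> * P) * ?e \<le> \<tau> * (\<beta> * B) * ?d" using False by (simp add: less_le)
  also have "\<dots> \<le> (1 - \<tau> * P) * ?d"
  proof (rule mult_right_mono)
    have "0 \<le> \<tau> * P" using nonneg by simp
    then show "\<tau> * (\<beta> * B) \<le> 1 - \<tau> * P" using tau_B by (simp add: distrib_left mult.left_commute)
  qed simp
  finally show ?thesis using tau_P_less by simp
qed simp

lemma implicit_step_ex: "\<exists>U W. step Wt U U W"
proof -
  obtain c where c: "0 < c" "\<And>a. norm a \<le> c * nM a" using norm_le_nM by blast
  \<comment> \<open>The Newton map for the data \<open>Wt\<close>. A fixed point of its stream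
    component solves the implicit scheme.\<close>
  define \<Phi> where "\<Phi> u = (THE UW. step Wt u (fst UW) (snd UW))" for u
  have \<Phi>: "step Wt u (fst (\<Phi> u)) (snd (\<Phi> u))" for u
    unfolding \<Phi>_def using theI'[OF step_ex1[of Wt u]] .
  have nonexp: "norm (fst (\<Phi> u) - fst (\<Phi> v)) \<le> c * nM (u - v)" for u v
    using c(2)[of "fst (\<Phi> u) - fst (\<Phi> v)"] elliptic(1)[OF step_diff(2)[OF \<Phi>[of u] \<Phi>[of v]]]
      step_nonexpansive[OF \<Phi>[of u] \<Phi>[of v]] c(1)
    by (smt (verit) mult_left_mono)
  \<comment> \<open>The radius contains \<open>B + 1\<close> so that it is positive also when
    \<open>B = 0\<close>.\<close>
  have "continuous_on (cball 0 (c * (B + 1))) (\<lambda>u. fst (\<Phi> u))"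
  proof (rule continuous_at_imp_continuous_on, rule ballI)
    fix v :: "real^'n"
    have "isCont nM 0" using continuous_nM[of UNIV] by (simp add: continuous_on_eq_continuous_at)
    then have "isCont (\<lambda>u. nM (u - v)) v"
      by (intro isCont_o2[where f = "\<lambda>u. u - v" and g = nM]) (auto intro: continuous_intros)
    then have "((\<lambda>u. c * nM (u - v)) \<longlongrightarrow> c * nM (v - v)) (at v)"
      by (intro tendsto_mult tendsto_const) (simp add: isCont_def)
    then have "((\<lambda>u. c * nM (u - v)) \<longlongrightarrow> 0) (at v)" by simp
    then have "((\<lambda>u. fst (\<Phi> u) - fst (\<Phi> v)) \<longlongrightarrow> 0) (at v)"
      by (rule Lim_null_comparison[rotated]) (use nonexp in simp)
    then show "isCont (\<lambda>u. fst (\<Phi> u)) v" by (simp add: isCont_def LIM_zero_iff)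
  qed
  moreover have "fst (\<Phi> u) \<in> cball 0 (c * (B + 1))" for u
  proof -
    have "nM (fst (\<Phi> u)) \<le> B"
      using step_bound[OF \<Phi>[of u]] elliptic(1)[of "fst (\<Phi> u)" "snd (\<Phi> u)"] \<Phi>[of u]
      by (simp add: step_def)
    then have "c * nM (fst (\<Phi> u)) \<le> c * (B + 1)" using c(1) by (intro mult_left_mono) auto
    then show ?thesis using c(2)[of "fst (\<Phi> u)"] by simp
  qed
  ultimately obtain u where "fst (\<Phi> u) = u"
    using brouwer_ball[of "c * (B + 1)" 0 "\<lambda>u. fst (\<Phi> u)"] c(1) B_nonneg by auto
  then show ?thesis using \<Phi>[of u] by metis
qed

text \<open>The errors \<open>nM (Wk k - W)\<close> decrease and dominate \<open>nM (Uk k - U)\<close>, so both have the same limit;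
  the elliptic energy identity then forces the gradients of the stream errors to vanish in the limit,
  and \<open>S_bound_gr\<close> and \<open>R_bound\<close> bound the next vorticity error by these gradients. This works in the
  borderline case of contraction factor 1.\<close>

lemma newton_converges:
  assumes sol: "step Wt U U W" and it: "\<And>k. step Wt (Uk k) (Uk (Suc k)) (Wk (Suc k))"
  shows "Uk \<longlonglongrightarrow> U" and "Wk \<longlonglongrightarrow> W"
proof -
  define a b where "a k = nM (Wk (Suc k) - W)" and "b k = nM (Uk (Suc k) - U)" for k
  define g where "g k = gr (Uk (Suc k) - U)" for k
  have ell: "K *v (Uk (Suc k) - U) = M *v (Wk (Suc k) - W)" for k
    by (rule step_diff(2)[OF it sol])
  have ab: "b k \<le> a k" "(g k)\<^sup>2 \<le> b k * (a k - b k)" for k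
    using elliptic[OF ell, of k] by (auto simp: a_def b_def g_def)
  have ba: "a (Suc k) \<le> b k" for k
    using step_nonexpansive[OF it[of "Suc k"] sol] by (simp add: a_def b_def)
  have "decseq a" using ab(1) ba by (intro decseq_SucI) (meson order_trans)
  then have a_le: "a k \<le> a 0" for k by (simp add: decseq_def)
  obtain l where l: "a \<longlonglongrightarrow> l"
    using decseq_convergent[OF \<open>decseq a\<close>, of 0] by (auto simp: a_def)
  \<comment> \<open>The chain \<open>a (Suc k) \<le> b k \<le> a k\<close> replaces the gap
    \<open>a k - b k\<close> by a difference of consecutive terms of a convergent sequence.\<close>
  have gb: "(g k)\<^sup>2 \<le> a 0 * (a k - a (Suc k))" for k
  proof -
    have "b k * (a k - b k) \<le> a 0 * (a k - a (Suc k))"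
      using ab(1)[of k] ba[of k] a_le[of k] by (intro mult_mono) (auto simp: a_def)
    then show ?thesis using ab(2)[of k] by linarith
  qed
  have "(\<lambda>k. a 0 * (a k - a (Suc k))) \<longlonglongrightarrow> a 0 * (l - l)"
    by (intro tendsto_mult tendsto_diff tendsto_const l LIMSEQ_Suc[OF l])
  then have "(\<lambda>k. a 0 * (a k - a (Suc k))) \<longlonglongrightarrow> 0" by simp
  then have "(\<lambda>k. (g k)\<^sup>2) \<longlonglongrightarrow> 0"
    by (rule Lim_null_comparison[rotated]) (use gb in simp)
  then have "(\<lambda>k. sqrt ((g k)\<^sup>2)) \<longlonglongrightarrow> sqrt 0" by (rule tendsto_real_sqrt)
  then have g: "g \<longlonglongrightarrow> 0" by (simp add: g_def[abs_def] gr_nonneg)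
  obtain c where c: "0 < c" "\<And>a. norm a \<le> c * nM a" using norm_le_nM by blast
  define D where "D = \<tau> * (C * (c * a 0) * norm W)"
  define E where "E = \<tau> * (2 * P * a 0)"
  \<comment> \<open>In the identity for the next error, the advection term sees the old stream error
    only through \<open>g k\<close> and the transport term the new one through
    \<open>g (Suc k)\<close>; \<open>D\<close> and \<open>E\<close> collect the remaining bounded
    factors.\<close>
  have ab': "(a (Suc k))\<^sup>2 \<le> D * g k + E * g (Suc k)" for k
  proof -
    let ?e = "Wk (Suc (Suc k)) - W"
    have "norm ?e \<le> c * a (Suc k)" using c(2) by (simp add: a_def)
    also have "\<dots> \<le> c * a 0" using a_le c(1) by (intro mult_left_mono) auto
    finally have ne: "norm ?e \<le> c * a 0" .
    have "\<bar>?e \<bullet> (S (Uk (Suc k) - U) *v W)\<bar> \<le> C * g k * norm ?e * norm W"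
      using S_bound_gr by (simp add: g_def)
    also have "\<dots> \<le> C * g k * (c * a 0) * norm W"
      using ne by (intro mult_right_mono mult_left_mono) (auto simp: g_def gr_nonneg nonneg)
    finally have "- (?e \<bullet> (S (Uk (Suc k) - U) *v W)) \<le> C * g k * (c * a 0) * norm W" by linarith
    then have "\<tau> * - (?e \<bullet> (S (Uk (Suc k) - U) *v W)) \<le> \<tau> * (C * g k * (c * a 0) * norm W)"
      using nonneg(4) by (intro mult_left_mono) auto
    then have s: "- (\<tau> * (?e \<bullet> (S (Uk (Suc k) - U) *v W))) \<le> D * g k"
      by (simp add: D_def algebra_simps)
    have "\<bar>?e \<bullet> (R *v (Uk (Suc (Suc k)) - U))\<bar> \<le> 2 * P * g (Suc k) * a (Suc k)"
      using R_bound[of ?e "Uk (Suc (Suc k)) - U"] by (simp add: g_def a_def nM_def)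
    also have "\<dots> \<le> 2 * P * g (Suc k) * a 0"
      using a_le by (intro mult_left_mono) (auto simp: g_def gr_nonneg nonneg)
    finally have "\<tau> * (?e \<bullet> (R *v (Uk (Suc (Suc k)) - U))) \<le> \<tau> * (2 * P * g (Suc k) * a 0)"
      using nonneg(4) by simp
    then have "\<tau> * (?e \<bullet> (R *v (Uk (Suc (Suc k)) - U))) \<le> E * g (Suc k)"
      by (simp add: E_def algebra_simps)
    with s show ?thesis using step_diff(1)[OF it[of "Suc k"] sol] by (simp add: a_def)
  qed
  have "(\<lambda>k. D * g k + E * g (Suc k)) \<longlonglongrightarrow> D * 0 + E * 0"
    by (intro tendsto_add tendsto_mult tendsto_const g LIMSEQ_Suc[OF g])
  then have "(\<lambda>k. D * g k + E * g (Suc k)) \<longlonglongrightarrow> 0" by simp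
  then have "(\<lambda>k. (a (Suc k))\<^sup>2) \<longlonglongrightarrow> 0"
    by (rule Lim_null_comparison[rotated]) (use ab' in simp)
  then have "(\<lambda>k. sqrt ((a (Suc k))\<^sup>2)) \<longlonglongrightarrow> sqrt 0" by (rule tendsto_real_sqrt)
  then have "(\<lambda>k. a (Suc k)) \<longlonglongrightarrow> 0" by (simp add: a_def)
  then have a0: "a \<longlonglongrightarrow> 0" by (rule LIMSEQ_imp_Suc)
  have ca: "(\<lambda>k. c * a k) \<longlonglongrightarrow> 0" using tendsto_mult[OF tendsto_const a0, of c] by simp
  have "(\<lambda>k. Wk (Suc k) - W) \<longlonglongrightarrow> 0"
    by (rule Lim_null_comparison[OF _ ca]) (simp add: a_def c(2))
  then show "Wk \<longlonglongrightarrow> W" by (intro LIMSEQ_imp_Suc[of Wk]) (simp add: LIM_zero_iff)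
  have "norm (Uk (Suc k) - U) \<le> c * a k" for k
  proof -
    have "norm (Uk (Suc k) - U) \<le> c * b k" using c(2) by (simp add: b_def)
    also have "\<dots> \<le> c * a k" using ab(1) c(1) by (intro mult_left_mono) auto
    finally show ?thesis .
  qed
  then have "(\<lambda>k. Uk (Suc k) - U) \<longlonglongrightarrow> 0"
    by (intro Lim_null_comparison[OF _ ca]) simp
  then show "Uk \<longlonglongrightarrow> U" by (intro LIMSEQ_imp_Suc[of Uk]) (simp add: LIM_zero_iff)
qed

lemma implicit_step_unique:
  assumes "step Wt U U W" and "step Wt X X Y"
  shows "X = U" and "Y = W"
  using newton_converges[OF assms(1), of "\<lambda>_. X" "\<lambda>_. Y"] assms(2)
  by (auto simp: LIMSEQ_const_iff)

text \<open>Iterating a map on pairs realises both prescribed initial vectors; the recursion itself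
  reads only the stream component of the previous pair.\<close>

lemma newton_sequence_ex:
  obtains Uk Wk where "Uk 0 = Ui" "Wk 0 = Wi" "\<And>k. step Wt (Uk k) (Uk (Suc k)) (Wk (Suc k))"
proof -
  define \<Phi> where "\<Phi> UW = (THE UW'. step Wt (fst UW) (fst UW') (snd UW'))" for UW :: "(real^'n) \<times> (real^'n)"
  have \<Phi>: "step Wt (fst UW) (fst (\<Phi> UW)) (snd (\<Phi> UW))" for UW
    unfolding \<Phi>_def using theI'[OF step_ex1[of Wt "fst UW"]] .
  show ?thesis
    by (rule that[of "\<lambda>k. fst ((\<Phi> ^^ k) (Ui, Wi))" "\<lambda>k. snd ((\<Phi> ^^ k) (Ui, Wi))"]) (simp_all add: \<Phi>)
qed

end

section \<open>Integration over right triangles\<close>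

text \<open>The two quotients are barycentric coordinates relative to the legs
  \<open>\<alpha>\<close> and \<open>\<beta>\<close>, which may have either sign; one formula thus
  covers all four orientations. The triangle is open, so that functions affine on it are
  differentiable there.\<close>

definition right_triangle :: "real \<times> real \<Rightarrow> real \<Rightarrow> real \<Rightarrow> (real \<times> real) set" where
  "right_triangle c \<alpha> \<beta> = {z. 0 < (fst z - fst c) / \<alpha> \<and> 0 < (snd z - snd c) / \<beta> \<and>
     (fst z - fst c) / \<alpha> + (snd z - snd c) / \<beta> < 1}"

lemma open_right_triangle: "open (right_triangle c \<alpha> \<beta>)"
proof -
  have "continuous_on UNIV (\<lambda>z::real \<times> real. fst z - fst c)"
       "continuous_on UNIV (\<lambda>z::real \<times> real. snd z - snd c)" by (intro continuous_intros)+
  then show ?thesis unfolding right_triangle_def divide_inverse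
    by (intro open_Collect_conj open_Collect_less continuous_intros)
qed

lemma right_triangle_subset_hull:
  assumes "\<alpha> \<noteq> 0" "\<beta> \<noteq> 0"
  shows "right_triangle c \<alpha> \<beta> \<subseteq> convex hull {c, (fst c + \<alpha>, snd c), (fst c, snd c + \<beta>)}"
proof
  fix z assume z: "z \<in> right_triangle c \<alpha> \<beta>"
  define l m where "l = (fst z - fst c) / \<alpha>" and "m = (snd z - snd c) / \<beta>"
  have "z = (1 - l - m) *\<^sub>R c + l *\<^sub>R (fst c + \<alpha>, snd c) + m *\<^sub>R (fst c, snd c + \<beta>)"
  proof (rule prod_eqI)
    have "l * \<alpha> = fst z - fst c" "m * \<beta> = snd z - snd c" using assms by (simp_all add: l_def m_def)
    then show "fst z = fst ((1 - l - m) *\<^sub>R c + l *\<^sub>R (fst c + \<alpha>, snd c) + m *\<^sub>R (fst c, snd c + \<beta>))"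
      "snd z = snd ((1 - l - m) *\<^sub>R c + l *\<^sub>R (fst c + \<alpha>, snd c) + m *\<^sub>R (fst c, snd c + \<beta>))"
      by (simp_all add: algebra_simps)
  qed
  moreover have "0 \<le> 1 - l - m" "0 \<le> l" "0 \<le> m"
    using z by (auto simp: right_triangle_def l_def m_def)
  ultimately show "z \<in> convex hull {c, (fst c + \<alpha>, snd c), (fst c, snd c + \<beta>)}"
    unfolding convex_hull_3 by (intro CollectI exI[of _ "1 - l - m"] exI[of _ l] exI[of _ m]) simp
qed

text \<open>Serves both iterated integrals over the unit triangle; the inner one has quadratic
  coefficient 0.\<close>

lemma integral_quadratic:
  fixes a :: real
  assumes "0 \<le> a"
  shows "(\<integral>x. (p + q * x + r * x\<^sup>2) * indicator {0<..<a} x \<partial>lborel) = p * a + q * a\<^sup>2 / 2 + r * a ^ 3 / 3"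
proof -
  have "(\<integral>x. (p + q * x + r * x\<^sup>2) * indicator {0<..<a} x \<partial>lborel) =
      (\<integral>x. (p + q * x + r * x\<^sup>2) * indicator {0..a} x \<partial>lborel)"
  proof (intro integral_cong_AE)
    have "AE x in lborel. x \<noteq> 0 \<and> x \<noteq> a" using AE_lborel_singleton[of 0] AE_lborel_singleton[of a] by auto
    then show "AE x in lborel. (p + q * x + r * x\<^sup>2) * indicator {0<..<a} x = (p + q * x + r * x\<^sup>2) * indicator {0..a} x"
      by eventually_elim (auto simp: indicator_def)
  qed measurable
  also have "\<dots> = (p * a + q * a\<^sup>2 / 2 + r * a ^ 3 / 3) - (p * 0 + q * 0\<^sup>2 / 2 + r * 0 ^ 3 / 3)"
    by (rule integral_FTC_Icc_real[OF assms])
      (auto intro!: derivative_eq_intros continuous_intros simp: power2_eq_square)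
  finally show ?thesis by simp
qed

lemma integral_unit_triangle:
  "(\<integral>z. indicator (right_triangle (0, 0) 1 1) z * (p + q * fst z + r * snd z) \<partial>lborel) =
    p / 2 + (q + r) / (6::real)"
proof -
  let ?T = "right_triangle (0, 0) 1 1"
  let ?f = "\<lambda>z. indicator ?T z * (p + q * fst z + r * snd z)"
  have [measurable]: "?T \<in> sets borel" using open_right_triangle by simp
  have [measurable]: "fst \<in> borel_measurable (borel :: (real \<times> real) measure)"
      "snd \<in> borel_measurable (borel :: (real \<times> real) measure)"
    by (intro borel_measurable_continuous_onI continuous_intros)+
  have sub: "?T \<subseteq> cbox (0, 0) (1, 1)" by (auto simp: right_triangle_def cbox_Pair_eq)
  have "integrable lborel (\<lambda>z. indicator (cbox (0, 0) (1, 1)) z *\<^sub>R (p + q * fst z + r * snd z))"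
    by (intro borel_integrable_compact compact_cbox continuous_intros)
  then have "integrable lborel ?f"
  proof (rule Bochner_Integration.integrable_bound)
    show "?f \<in> borel_measurable lborel" by measurable
  qed (use sub in \<open>auto simp: indicator_def\<close>)
  then have "integral\<^sup>L lborel ?f = (\<integral>x. \<integral>y. ?f (x, y) \<partial>lborel \<partial>lborel)"
    unfolding lborel_prod[symmetric] by (subst lborel_pair.integral_fst') simp_all
  \<comment> \<open>The inner integral over \<open>0 < y < 1 - x\<close>, expanded in powers of
    \<open>x\<close>.\<close>
  also have "\<dots> = (\<integral>x. ((p + r / 2) + (q - p - r) * x + (r / 2 - q) * x\<^sup>2) * indicator {0<..<1} x \<partial>lborel)"
  proof (intro Bochner_Integration.integral_cong refl)
    fix x :: real
    show "(\<integral>y. ?f (x, y) \<partial>lborel) = ((p + r / 2) + (q - p - r) * x + (r / 2 - q) * x\<^sup>2) * indicator {0<..<1} x"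
    proof (cases "0 < x \<and> x < 1")
      case True
      then have f: "(\<lambda>y. ?f (x, y)) = (\<lambda>y. ((p + q * x) + r * y + 0 * y\<^sup>2) * indicator {0<..<1 - x} y)"
        by (intro ext) (auto simp: right_triangle_def split: split_indicator)
      have "(\<integral>y. ?f (x, y) \<partial>lborel) = (p + q * x) * (1 - x) + r * (1 - x)\<^sup>2 / 2 + 0 * (1 - x) ^ 3 / 3"
        unfolding f by (rule integral_quadratic) (use True in simp)
      then show ?thesis using True by (simp add: power2_eq_square field_simps)
    next
      case False
      then have "(\<lambda>y. ?f (x, y)) = (\<lambda>y. 0)" by (auto simp: right_triangle_def indicator_def)
      then show ?thesis using False by simp
    qed
  qed
  also have "\<dots> = p / 2 + (q + r) / 6"
    by (subst integral_quadratic) (simp_all add: field_simps)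
  finally show ?thesis .
qed

lemma integral_right_triangle:
  assumes "\<alpha> \<noteq> 0" "\<beta> \<noteq> 0"
  shows "(\<integral>z. indicator (right_triangle c \<alpha> \<beta>) z *
      (p + q * ((fst z - fst c) / \<alpha>) + r * ((snd z - snd c) / \<beta>)) \<partial>lebesgue) =
    \<bar>\<alpha> * \<beta>\<bar> * (p / 2 + (q + r) / (6::real))"
proof -
  let ?f = "\<lambda>z. indicator (right_triangle c \<alpha> \<beta>) z *
      (p + q * ((fst z - fst c) / \<alpha>) + r * ((snd z - snd c) / \<beta>))"
  \<comment> \<open>The affine map from the unit triangle to the given one, with Jacobian
    \<open>\<alpha> * \<beta>\<close> up to sign. The sum over the basis is the shape that
    \<open>lborel_affine_euclidean\<close> expects.\<close>
  define T where "T = (\<lambda>x::real \<times> real. c + (\<Sum>j\<in>Basis. ((\<alpha>, \<beta>) \<bullet> j * (x \<bullet> j)) *\<^sub>R j))"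
  have T: "T z = (fst c + \<alpha> * fst z, snd c + \<beta> * snd z)" for z
    by (simp add: T_def Basis_prod_def sum.union_disjoint prod_eq_iff inner_prod_def)
  have [measurable]: "right_triangle c \<alpha> \<beta> \<in> sets borel" using open_right_triangle by simp
  have [measurable]: "fst \<in> borel_measurable (borel :: (real \<times> real) measure)"
      "snd \<in> borel_measurable (borel :: (real \<times> real) measure)"
    by (intro borel_measurable_continuous_onI continuous_intros)+
  have [measurable]: "T \<in> borel \<rightarrow>\<^sub>M borel" unfolding T_def by measurable
  have [measurable]: "?f \<in> borel_measurable borel" by measurable
  have B: "(\<Prod>j\<in>(Basis :: (real \<times> real) set). \<bar>(\<alpha>, \<beta>) \<bullet> j\<bar>) = \<bar>\<alpha> * \<beta>\<bar>"
    by (simp add: Basis_prod_def abs_mult)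
  have L: "lborel = density (distr lborel borel T) (\<lambda>_. ennreal \<bar>\<alpha> * \<beta>\<bar>)"
    unfolding T_def B[symmetric]
    by (rule lborel_affine_euclidean) (use assms in \<open>auto simp: Basis_prod_def\<close>)
  have "integral\<^sup>L lebesgue ?f = integral\<^sup>L lborel ?f" by (rule integral_completion) measurable
  also have "\<dots> = (\<integral>z. \<bar>\<alpha> * \<beta>\<bar> * ?f (T z) \<partial>lborel)"
    by (subst L, subst integral_density) (auto simp: integral_distr)
  also have "\<dots> = \<bar>\<alpha> * \<beta>\<bar> * (\<integral>z. ?f (T z) \<partial>lborel)" by simp
  also have "(\<lambda>z. ?f (T z)) = (\<lambda>z. indicator (right_triangle (0, 0) 1 1) z * (p + q * fst z + r * snd z))"
    using assms by (auto simp: right_triangle_def indicator_def T)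
  finally show ?thesis by (simp only: integral_unit_triangle)
qed

text \<open>An affine function is determined by its values at the three vertices, and the open
  triangle is a neighbourhood of \<open>z\<close>, so the derivative of \<open>v\<close> at
  \<open>z\<close> is that of the affine function.\<close>

lemma grad_formula:
  fixes v :: "real \<times> real \<Rightarrow> real"
  assumes nz: "\<alpha> \<noteq> 0" "\<beta> \<noteq> 0"
    and aff: "\<forall>z \<in> convex hull {c, (fst c + \<alpha>, snd c), (fst c, snd c + \<beta>)}. v z = a + b \<bullet> z"
    and z: "z \<in> right_triangle c \<alpha> \<beta>"
  shows "v z = v c + (v (fst c + \<alpha>, snd c) - v c) * ((fst z - fst c) / \<alpha>) + (v (fst c, snd c + \<beta>) - v c) * ((snd z - snd c) / \<beta>)"
    and "frechet_derivative v (at z) =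
      (\<lambda>e. fst e * ((v (fst c + \<alpha>, snd c) - v c) / \<alpha>) + snd e * ((v (fst c, snd c + \<beta>) - v c) / \<beta>))"
proof -
  let ?H = "convex hull {c, (fst c + \<alpha>, snd c), (fst c, snd c + \<beta>)}"
  have "c \<in> ?H" "(fst c + \<alpha>, snd c) \<in> ?H" "(fst c, snd c + \<beta>) \<in> ?H" by (auto intro: hull_inc)
  then have vc: "v c = a + b \<bullet> c" "v (fst c + \<alpha>, snd c) - v c = fst b * \<alpha>"
      "v (fst c, snd c + \<beta>) - v c = snd b * \<beta>"
    using aff by (auto simp: inner_prod_def algebra_simps)
  have on: "v y = a + b \<bullet> y" if "y \<in> right_triangle c \<alpha> \<beta>" for y
    using aff right_triangle_subset_hull[OF nz] that by blast
  show "v z = v c + (v (fst c + \<alpha>, snd c) - v c) * ((fst z - fst c) / \<alpha>) + (v (fst c, snd c + \<beta>) - v c) * ((snd z - snd c) / \<beta>)"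
  proof -
    have "fst b * \<alpha> * ((fst z - fst c) / \<alpha>) = fst b * (fst z - fst c)"
      "snd b * \<beta> * ((snd z - snd c) / \<beta>) = snd b * (snd z - snd c)" using nz by simp_all
    then show ?thesis
      unfolding vc(2,3) unfolding vc(1) on[OF z] by (simp add: inner_prod_def algebra_simps)
  qed
  have "((\<lambda>y. a + b \<bullet> y) has_derivative (\<lambda>e. b \<bullet> e)) (at z)" by (auto intro!: derivative_eq_intros)
  then have "(v has_derivative (\<lambda>e. b \<bullet> e)) (at z)"
    by (rule has_derivative_transform_within_open[OF _ open_right_triangle z]) (simp add: on)
  then show "frechet_derivative v (at z) =
      (\<lambda>e. fst e * ((v (fst c + \<alpha>, snd c) - v c) / \<alpha>) + snd e * ((v (fst c, snd c + \<beta>) - v c) / \<beta>))"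
    unfolding vc(2,3) using nz by (subst frechet_derivative_at[symmetric]) (auto simp: inner_prod_def mult.commute)
qed

section \<open>The triangulated square\<close>

lemma L2_mult_integrable:
  fixes f g :: "'a \<Rightarrow> real"
  assumes [measurable]: "f \<in> borel_measurable M" "g \<in> borel_measurable M"
    and "integrable M (\<lambda>x. (f x)\<^sup>2)" "integrable M (\<lambda>x. (g x)\<^sup>2)"
  shows "integrable M (\<lambda>x. f x * g x)"
proof (rule Bochner_Integration.integrable_bound)
  show "integrable M (\<lambda>x. (f x)\<^sup>2 + (g x)\<^sup>2)" using assms by simp
  have "\<bar>f x * g x\<bar> \<le> (f x)\<^sup>2 + (g x)\<^sup>2" for x
  proof -
    have "2 * (\<bar>f x\<bar> * \<bar>g x\<bar>) \<le> (f x)\<^sup>2 + (g x)\<^sup>2"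
      using sum_squares_bound[of "\<bar>f x\<bar>" "\<bar>g x\<bar>"] by simp
    moreover have "0 \<le> \<bar>f x\<bar> * \<bar>g x\<bar>" by simp
    ultimately show ?thesis unfolding abs_mult by linarith
  qed
  then show "AE x in M. norm (f x * g x) \<le> norm ((f x)\<^sup>2 + (g x)\<^sup>2)" by simp
qed measurable

text \<open>Vector-valued, so that it applies to gradient fields as well as to scalar
  functions.\<close>

lemma L2_Cauchy_Schwarz:
  fixes f g :: "'a \<Rightarrow> 'b :: real_inner"
  assumes "integrable M (\<lambda>x. f x \<bullet> f x)" "integrable M (\<lambda>x. g x \<bullet> g x)" "integrable M (\<lambda>x. f x \<bullet> g x)"
  shows "(\<integral>x. f x \<bullet> g x \<partial>M)\<^sup>2 \<le> (\<integral>x. f x \<bullet> f x \<partial>M) * (\<integral>x. g x \<bullet> g x \<partial>M)"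
proof (rule quadratic_nonneg_discriminant)
  fix t
  have "(\<integral>x. (t *\<^sub>R f x + g x) \<bullet> (t *\<^sub>R f x + g x) \<partial>M) =
      (\<integral>x. t\<^sup>2 * (f x \<bullet> f x) + 2 * t * (f x \<bullet> g x) + g x \<bullet> g x \<partial>M)"
    by (simp add: inner_simps inner_commute power2_eq_square algebra_simps)
  also have "\<dots> = (\<integral>x. f x \<bullet> f x \<partial>M) * t\<^sup>2 + 2 * (\<integral>x. f x \<bullet> g x \<partial>M) * t + (\<integral>x. g x \<bullet> g x \<partial>M)"
    using assms by simp
  finally show "0 \<le> (\<integral>x. f x \<bullet> f x \<partial>M) * t\<^sup>2 + 2 * (\<integral>x. f x \<bullet> g x \<partial>M) * t + (\<integral>x. g x \<bullet> g x \<partial>M)"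
    by (metis (mono_tags, lifting) Bochner_Integration.integral_nonneg inner_ge_zero)
qed simp

text \<open>Since \<open>x\<close> is not a node, adding the interval that starts at
  \<open>xs m\<close> turns the indicator of \<open>x < xs m\<close> into that of
  \<open>x < xs (Suc m)\<close>. At the last node this says that the intervals partition the side up
  to its nodes.\<close>

lemma grid_interval_count:
  fixes xs :: "nat \<Rightarrow> real"
  assumes "strict_mono_on {..<n} xs" and "x \<notin> xs ` {..<n}" and "xs 0 < x"
  shows "m < n \<Longrightarrow> (\<Sum>i<m. of_bool (xs i < x \<and> x < xs (Suc i))) = (of_bool (x < xs m) :: real)"
proof (induction m)
  case (Suc m)
  then have "xs m < xs (Suc m)" using assms(1) by (auto simp: strict_mono_on_def)
  moreover have "x \<noteq> xs m" using assms(2) Suc.prems by auto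
  ultimately show ?case using Suc by auto
qed (use assms in auto)

lemma grid_step: "grid L n xs \<Longrightarrow> i < n - 1 \<Longrightarrow> xs i < xs (Suc i)"
  using less_diff_conv[of i n 1] by (auto simp: grid_def strict_mono_on_def)

lemma grid_bounds:
  assumes "grid L n xs" "i < n"
  shows "0 \<le> xs i" "xs i \<le> L"
proof -
  have "mono_on {..<n} xs" using assms by (auto simp: grid_def strict_mono_on_imp_mono_on)
  then show "0 \<le> xs i" "xs i \<le> L"
    using monotone_onD[of "{..<n}" "(\<le>)" "(\<le>)" xs 0 i] monotone_onD[of "{..<n}" "(\<le>)" "(\<le>)" xs i "n - 1"] assms
    by (auto simp: grid_def)
qed

section \<open>The triangles as an indexed family that partitions the square\<close>

locale fem_grid =
  fixes L :: real and n :: nat and xs ys :: "nat \<Rightarrow> real" and d :: "nat \<Rightarrow> nat \<Rightarrow> bool"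
  assumes grid_xs: "grid L n xs" and grid_ys: "grid L n ys"
begin

text \<open>The triangle \<open>(i, j, s)\<close> of the cell \<open>(i, j)\<close> has its right angle at the grid point
  \<open>(ci, cj)\<close>; \<open>hi\<close> and \<open>vj\<close> index the other endpoints of its horizontal and vertical legs.\<close>

definition "ci = (\<lambda>(i, j, s). if d i j = s then Suc i else i)"
definition "hi = (\<lambda>(i, j, s). if d i j = s then i else Suc i)"
definition "cj = (\<lambda>(i :: nat, j, s). if s then j else Suc j)"
definition "vj = (\<lambda>(i :: nat, j, s). if s then Suc j else j)"

lemmas index_defs = ci_def hi_def cj_def vj_def

definition leg_x where "leg_x t = xs (hi t) - xs (ci t)"
definition leg_y where "leg_y t = ys (vj t) - ys (cj t)"

definition tri where "tri t = right_triangle (xs (ci t), ys (cj t)) (leg_x t) (leg_y t)"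

definition indices :: "(nat \<times> nat \<times> bool) set" where
  "indices = {..<n - 1} \<times> {..<n - 1} \<times> UNIV"

lemma finite_indices [simp]: "finite indices"
  by (simp add: indices_def)

lemma legs_nonzero: "t \<in> indices \<Longrightarrow> leg_x t \<noteq> 0" "t \<in> indices \<Longrightarrow> leg_y t \<noteq> 0"
proof -
  assume "t \<in> indices"
  then obtain i j s where ij: "t = (i, j, s)" "i < n - 1" "j < n - 1" by (auto simp: indices_def)
  have "xs i < xs (Suc i)" "ys j < ys (Suc j)" using ij grid_step grid_xs grid_ys by blast+
  then show "leg_x t \<noteq> 0" "leg_y t \<noteq> 0" by (auto simp: ij leg_x_def leg_y_def index_defs)
qed

text \<open>In the unit-cell coordinates \<open>\<xi>\<close> and \<open>\<eta>\<close>, the numbers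
  \<open>l\<close> and \<open>m\<close> are barycentric coordinates measured from the right angle.
  Geometric questions become linear case distinctions.\<close>

lemma tri_iff:
  assumes "i < n - 1" "j < n - 1"
  shows "z \<in> tri (i, j, s) \<longleftrightarrow>
    (let \<xi> = (fst z - xs i) / (xs (Suc i) - xs i); \<eta> = (snd z - ys j) / (ys (Suc j) - ys j);
         l = if d i j = s then 1 - \<xi> else \<xi>; m = if s then \<eta> else 1 - \<eta>
     in 0 < l \<and> 0 < m \<and> l + m < 1)"
proof -
  have "xs i < xs (Suc i)" "ys j < ys (Suc j)" using assms grid_step grid_xs grid_ys by blast+
  then have "(fst z - xs (Suc i)) / (xs i - xs (Suc i)) = 1 - (fst z - xs i) / (xs (Suc i) - xs i)"
    "(snd z - ys (Suc j)) / (ys j - ys (Suc j)) = 1 - (snd z - ys j) / (ys (Suc j) - ys j)"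
    by (simp_all add: divide_simps) (simp_all add: algebra_simps)
  then show ?thesis
    unfolding tri_def right_triangle_def leg_x_def leg_y_def index_defs by (simp add: Let_def)
qed

text \<open>The whole line through the diagonal, not only its segment in the cell: one linear
  equation describes it, and it is still a null set.\<close>

definition on_diagonal :: "nat \<Rightarrow> nat \<Rightarrow> (real \<times> real) set" where
  "on_diagonal i j = {z. (if d i j then (fst z - xs i) / (xs (Suc i) - xs i) = (snd z - ys j) / (ys (Suc j) - ys j)
     else (fst z - xs i) / (xs (Suc i) - xs i) + (snd z - ys j) / (ys (Suc j) - ys j) = 1)}"

lemma cell_partition:
  assumes "i < n - 1" "j < n - 1" "z \<notin> on_diagonal i j"
  shows "indicator (tri (i, j, True)) z + indicator (tri (i, j, False)) z =
    (of_bool (xs i < fst z \<and> fst z < xs (Suc i)) * of_bool (ys j < snd z \<and> snd z < ys (Suc j)) :: real)"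
proof -
  define \<xi> \<eta> where "\<xi> = (fst z - xs i) / (xs (Suc i) - xs i)" and "\<eta> = (snd z - ys j) / (ys (Suc j) - ys j)"
  have "xs i < xs (Suc i)" "ys j < ys (Suc j)" using assms grid_step grid_xs grid_ys by blast+
  then have "xs i < fst z \<and> fst z < xs (Suc i) \<longleftrightarrow> 0 < \<xi> \<and> \<xi> < 1"
    "ys j < snd z \<and> snd z < ys (Suc j) \<longleftrightarrow> 0 < \<eta> \<and> \<eta> < 1"
    by (auto simp: \<xi>_def \<eta>_def zero_less_divide_iff)
  moreover have "if d i j then \<xi> \<noteq> \<eta> else \<xi> + \<eta> \<noteq> 1"
    using assms(3) by (auto simp: on_diagonal_def \<xi>_def \<eta>_def)
  ultimately show ?thesis
    unfolding indicator_def tri_iff[OF assms(1,2)] Let_def \<xi>_def[symmetric] \<eta>_def[symmetric]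
    by (cases "d i j") auto
qed

lemma tri_subset_Omega: "t \<in> indices \<Longrightarrow> tri t \<subseteq> Omega L"
proof
  fix z assume t: "t \<in> indices" and z: "z \<in> tri t"
  obtain i j s where ij: "t = (i, j, s)" "i < n - 1" "j < n - 1" using t by (auto simp: indices_def)
  define \<xi> \<eta> where "\<xi> = (fst z - xs i) / (xs (Suc i) - xs i)" and "\<eta> = (snd z - ys j) / (ys (Suc j) - ys j)"
  have "xs i < xs (Suc i)" "ys j < ys (Suc j)" using ij grid_step grid_xs grid_ys by blast+
  moreover have "0 < \<xi> \<and> \<xi> < 1" "0 < \<eta> \<and> \<eta> < 1"
    using z unfolding ij(1) tri_iff[OF ij(2,3)] Let_def \<xi>_def[symmetric] \<eta>_def[symmetric]
    by (auto split: if_splits)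
  ultimately have "xs i < fst z \<and> fst z < xs (Suc i)" "ys j < snd z \<and> snd z < ys (Suc j)"
    by (auto simp: \<xi>_def \<eta>_def zero_less_divide_iff)
  moreover have "0 \<le> xs i" "0 \<le> ys j" "xs (Suc i) \<le> L" "ys (Suc j) \<le> L"
    using grid_bounds[OF grid_xs] grid_bounds[OF grid_ys] ij by auto
  ultimately show "z \<in> Omega L" by (auto simp: Omega_def mem_Times_iff)
qed

lemma negligible_skeleton:
  "negligible ({z. fst z \<in> xs ` {..<n}} \<union> {z. snd z \<in> ys ` {..<n}} \<union> (\<Union>i<n - 1. \<Union>j<n - 1. on_diagonal i j))"
proof -
  have "{z :: real \<times> real. fst z \<in> xs ` {..<n}} = (\<Union>i<n. {z. (1, 0) \<bullet> z = xs i})"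
    "{z :: real \<times> real. snd z \<in> ys ` {..<n}} = (\<Union>i<n. {z. (0, 1) \<bullet> z = ys i})"
    by (auto simp: inner_prod_def)
  moreover have "negligible (on_diagonal i j)" if "i < n - 1" "j < n - 1" for i j
  proof -
    have "xs i < xs (Suc i)" "ys j < ys (Suc j)" using that grid_step grid_xs grid_ys by blast+
    moreover define a b where "a = 1 / (xs (Suc i) - xs i)" and "b = 1 / (ys (Suc j) - ys j)"
    ultimately have "a \<noteq> 0" by simp
    have "on_diagonal i j = {z. (a, if d i j then - b else b) \<bullet> z =
        a * xs i + (if d i j then - b * ys j else 1 + b * ys j)}"
      by (auto simp: on_diagonal_def inner_prod_def a_def b_def divide_inverse algebra_simps)
    then show ?thesis using \<open>a \<noteq> 0\<close> by (auto intro!: negligible_hyperplane simp: zero_prod_def)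
  qed
  ultimately show ?thesis
    by (auto intro!: negligible_Un negligible_Union negligible_hyperplane simp: zero_prod_def)
qed

lemma Omega_lmeasurable [simp]: "Omega L \<in> lmeasurable"
proof -
  have "Omega L = box (0, 0) (L, L)" by (auto simp: Omega_def box_def Basis_prod_def)
  then show ?thesis by simp
qed

lemma Omega_sets [simp, measurable]: "Omega L \<in> sets lebesgue"
  using Omega_lmeasurable by blast

text \<open>Off the skeleton the two triangles of a cell add up to a product of interval indicators,
  so the total factors into one interval count per axis, and each count is 1.\<close>

lemma AE_partition: "AE z in lebesgue_on (Omega L). (\<Sum>t\<in>indices. indicator (tri t) z) = (1 :: real)"
proof -
  let ?N = "{z. fst z \<in> xs ` {..<n}} \<union> {z. snd z \<in> ys ` {..<n}} \<union> (\<Union>i<n - 1. \<Union>j<n - 1. on_diagonal i j)"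
  have one: "(\<Sum>t\<in>indices. indicator (tri t) z) = (1 :: real)" if "z \<notin> ?N" "z \<in> Omega L" for z
  proof -
    have n: "n - 1 < n" and e: "xs 0 = 0" "ys 0 = 0" "xs (n - 1) = L" "ys (n - 1) = L"
      using grid_xs grid_ys by (auto simp: grid_def)
    have "(\<Sum>t\<in>indices. indicator (tri t) z) =
        (\<Sum>i<n - 1. \<Sum>j<n - 1. indicator (tri (i, j, True)) z + indicator (tri (i, j, False)) z)"
      unfolding indices_def by (simp add: sum.cartesian_product' UNIV_bool add.commute)
    also have "\<dots> = (\<Sum>i<n - 1. \<Sum>j<n - 1.
        of_bool (xs i < fst z \<and> fst z < xs (Suc i)) * of_bool (ys j < snd z \<and> snd z < ys (Suc j)) :: real)"
      using that by (intro sum.cong refl cell_partition) auto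
    also have "\<dots> = (\<Sum>i<n - 1. of_bool (xs i < fst z \<and> fst z < xs (Suc i))) *
        (\<Sum>j<n - 1. of_bool (ys j < snd z \<and> snd z < ys (Suc j)))"
      by (rule sum_product[symmetric])
    also have "\<dots> = 1"
      using that grid_xs grid_ys n e
      by (subst (1 2) grid_interval_count[where n = n]) (auto simp: grid_def Omega_def)
    finally show ?thesis .
  qed
  have "?N \<in> null_sets lebesgue" using negligible_skeleton negligible_iff_null_sets by blast
  then have "AE z in lebesgue. z \<notin> ?N" by (rule AE_not_in)
  then have "AE z in lebesgue. z \<in> Omega L \<longrightarrow> (\<Sum>t\<in>indices. indicator (tri t) z) = (1 :: real)"
    by (rule eventually_mono) (use one in blast)
  then show ?thesis by (subst AE_restrict_space_iff) simp_all
qed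


text \<open>Agreement is required only on the open triangles, because the classical gradient is
  unspecified on the edges. Each piece is continuous on the plane, hence measurable and bounded on
  the square.\<close>

definition piecewise :: "(nat \<times> nat \<times> bool \<Rightarrow> real \<times> real \<Rightarrow> real) \<Rightarrow> (real \<times> real \<Rightarrow> real) \<Rightarrow> bool" where
  "piecewise f F \<longleftrightarrow> (\<forall>t\<in>indices. continuous_on UNIV (f t) \<and> (\<forall>z\<in>tri t. F z = f t z))"

lemma open_tri: "open (tri t)"
  by (simp add: tri_def open_right_triangle)

lemma piecewise_AE:
  assumes "piecewise f F"
  shows "AE z in lebesgue_on (Omega L). F z = (\<Sum>t\<in>indices. indicator (tri t) z * f t z)"
  using AE_partition
proof eventually_elim
  case (elim z)
  have "F z = (\<Sum>t\<in>indices. indicator (tri t) z * F z)"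
    using elim by (simp flip: sum_distrib_right)
  also have "\<dots> = (\<Sum>t\<in>indices. indicator (tri t) z * f t z)"
    using assms by (intro sum.cong) (auto simp: piecewise_def indicator_def)
  finally show ?case .
qed

text \<open>Completeness of Lebesgue measure, applied after extending both functions by 0 to the
  plane.\<close>

lemma lebesgue_on_measurable_AE:
  fixes F G :: "real \<times> real \<Rightarrow> real"
  assumes "G \<in> borel_measurable (lebesgue_on (Omega L))" and "AE z in lebesgue_on (Omega L). F z = G z"
  shows "F \<in> borel_measurable (lebesgue_on (Omega L))"
proof -
  have "(\<lambda>z. if z \<in> Omega L then G z else 0) \<in> borel_measurable lebesgue"
    using assms(1) by (simp add: borel_measurable_if)
  moreover have "AE z in lebesgue. (if z \<in> Omega L then G z else 0) = (if z \<in> Omega L then F z else 0)"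
    using assms(2) by (subst (asm) AE_restrict_space_iff) (auto elim: eventually_mono)
  ultimately have "(\<lambda>z. if z \<in> Omega L then F z else 0) \<in> borel_measurable lebesgue"
    by (rule borel_measurable_AE)
  then show ?thesis by (simp add: borel_measurable_if)
qed

text \<open>Essentially bounded measurable functions form an algebra and are integrable on the
  square, which has finite measure. Their closure rules settle the integrability of the finite
  element integrands.\<close>

definition bdd_meas :: "(real \<times> real \<Rightarrow> real) \<Rightarrow> bool" where
  "bdd_meas F \<longleftrightarrow> F \<in> borel_measurable (lebesgue_on (Omega L)) \<and>
     (\<exists>B. AE z in lebesgue_on (Omega L). \<bar>F z\<bar> \<le> B)"

lemma bdd_meas_measurable: "bdd_meas F \<Longrightarrow> F \<in> borel_measurable (lebesgue_on (Omega L))"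
  by (simp add: bdd_meas_def)

lemma finite_measure_Omega: "finite_measure (lebesgue_on (Omega L))"
  by (simp add: finite_measure_lebesgue_on)

lemma bdd_meas_integrable:
  assumes "bdd_meas F"
  shows "integrable (lebesgue_on (Omega L)) F"
proof -
  interpret finite_measure "lebesgue_on (Omega L)" by (rule finite_measure_Omega)
  from assms obtain B where "AE z in lebesgue_on (Omega L). \<bar>F z\<bar> \<le> B" by (auto simp: bdd_meas_def)
  then show ?thesis using assms by (intro integrable_const_bound[of _ B]) (auto simp: bdd_meas_def)
qed

lemma bdd_meas_const: "bdd_meas (\<lambda>_. c)"
  by (auto simp: bdd_meas_def)

lemma bdd_meas_add:
  assumes "bdd_meas F" "bdd_meas G"
  shows "bdd_meas (\<lambda>z. F z + G z)"
proof -
  obtain A B where "AE z in lebesgue_on (Omega L). \<bar>F z\<bar> \<le> A" "AE z in lebesgue_on (Omega L). \<bar>G z\<bar> \<le> B"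
    using assms by (auto simp: bdd_meas_def)
  then have "AE z in lebesgue_on (Omega L). \<bar>F z + G z\<bar> \<le> A + B" by eventually_elim linarith
  then show ?thesis using assms unfolding bdd_meas_def by (auto intro!: borel_measurable_add)
qed

lemma bdd_meas_mult:
  assumes "bdd_meas F" "bdd_meas G"
  shows "bdd_meas (\<lambda>z. F z * G z)"
proof -
  obtain A B where "AE z in lebesgue_on (Omega L). \<bar>F z\<bar> \<le> A" "AE z in lebesgue_on (Omega L). \<bar>G z\<bar> \<le> B"
    using assms by (auto simp: bdd_meas_def)
  then have "AE z in lebesgue_on (Omega L). \<bar>F z * G z\<bar> \<le> \<bar>A\<bar> * \<bar>B\<bar>"
  proof eventually_elim
    case (elim z)
    then show ?case unfolding abs_mult by (intro mult_mono) auto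
  qed
  then show ?thesis using assms unfolding bdd_meas_def by (auto intro!: borel_measurable_times)
qed

lemma bdd_meas_uminus: "bdd_meas F \<Longrightarrow> bdd_meas (\<lambda>z. - F z)"
  using bdd_meas_mult[OF bdd_meas_const[of "-1"]] by simp

lemma bdd_meas_diff: "bdd_meas F \<Longrightarrow> bdd_meas G \<Longrightarrow> bdd_meas (\<lambda>z. F z - G z)"
  using bdd_meas_add[OF _ bdd_meas_uminus, of F G] by simp

lemma bdd_meas_sum:
  "(\<And>i. i \<in> I \<Longrightarrow> bdd_meas (F i)) \<Longrightarrow> bdd_meas (\<lambda>z. \<Sum>i\<in>I. F i z)"
  by (induction I rule: infinite_finite_induct) (auto intro: bdd_meas_const bdd_meas_add)

lemma bdd_meas_power: "bdd_meas F \<Longrightarrow> bdd_meas (\<lambda>z. F z ^ k)"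
  by (induction k) (auto intro: bdd_meas_const bdd_meas_mult)

lemmas bdd_meas_intros = bdd_meas_const bdd_meas_add bdd_meas_mult bdd_meas_uminus bdd_meas_diff
  bdd_meas_sum bdd_meas_power

lemma bdd_meas_indicator: "open A \<Longrightarrow> bdd_meas (indicator A)"
proof -
  assume "open A"
  then have "A \<in> sets lebesgue" by (simp add: borel_open)
  then have "(indicator A :: _ \<Rightarrow> real) \<in> borel_measurable lebesgue" by simp
  moreover have "AE z in lebesgue_on (Omega L). \<bar>indicator A z :: real\<bar> \<le> 1" by (simp add: indicator_def)
  ultimately show ?thesis unfolding bdd_meas_def by (blast intro: measurable_restrict_space1)
qed

lemma bdd_meas_continuous:
  assumes "continuous_on UNIV f"
  shows "bdd_meas f"
proof -
  have "f \<in> borel_measurable borel" using assms by (rule borel_measurable_continuous_onI)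
  then have "f \<in> borel_measurable lebesgue" by (simp add: measurable_completion)
  moreover have "compact (Omega_bar L)" by (simp add: Omega_bar_def compact_Times)
  then have "bounded (f ` Omega_bar L)"
    using assms by (intro compact_imp_bounded compact_continuous_image) (auto intro: continuous_on_subset)
  then obtain b where b: "\<And>z. z \<in> Omega_bar L \<Longrightarrow> \<bar>f z\<bar> \<le> b" by (auto simp: bounded_iff)
  have "AE z in lebesgue_on (Omega L). z \<in> Omega L" by (simp add: AE_restrict_space_iff)
  then have "AE z in lebesgue_on (Omega L). \<bar>f z\<bar> \<le> b"
    by (rule eventually_mono) (auto intro!: b simp: Omega_def Omega_bar_def)
  ultimately show ?thesis unfolding bdd_meas_def by (blast intro: measurable_restrict_space1)
qed

lemma bdd_meas_cong_AE:
  assumes "bdd_meas G" and ae: "AE z in lebesgue_on (Omega L). F z = G z"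
  shows "bdd_meas F"
proof -
  obtain B where "AE z in lebesgue_on (Omega L). \<bar>G z\<bar> \<le> B" using assms by (auto simp: bdd_meas_def)
  with ae have "AE z in lebesgue_on (Omega L). \<bar>F z\<bar> \<le> B" by eventually_elim simp
  moreover have "F \<in> borel_measurable (lebesgue_on (Omega L))"
    using assms by (intro lebesgue_on_measurable_AE[OF _ ae]) (simp add: bdd_meas_def)
  ultimately show ?thesis unfolding bdd_meas_def by blast
qed

lemma piecewise_term_bdd_meas:
  assumes "piecewise f F" "t \<in> indices"
  shows "bdd_meas (\<lambda>z. indicator (tri t) z * f t z)"
  using assms by (intro bdd_meas_mult bdd_meas_indicator bdd_meas_continuous open_tri) (simp add: piecewise_def)

lemma piecewise_bdd_meas: "piecewise f F \<Longrightarrow> bdd_meas F"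
  by (rule bdd_meas_cong_AE[OF bdd_meas_sum piecewise_AE]) (rule piecewise_term_bdd_meas)

text \<open>The triangles lie in the square, so each summand may be integrated over the plane, where
  \<open>integral_right_triangle\<close> applies.\<close>

lemma integral_piecewise:
  assumes "piecewise f F"
  shows "(LINT z|lebesgue_on (Omega L). F z) = (\<Sum>t\<in>indices. LINT z|lebesgue. indicator (tri t) z * f t z)"
proof -
  let ?M = "lebesgue_on (Omega L)"
  have "(LINT z|?M. F z) = (LINT z|?M. (\<Sum>t\<in>indices. indicator (tri t) z * f t z))"
    by (intro integral_cong_AE piecewise_AE[OF assms] bdd_meas_measurable piecewise_bdd_meas[OF assms]
      bdd_meas_sum piecewise_term_bdd_meas[OF assms])
  also have "\<dots> = (\<Sum>t\<in>indices. LINT z|?M. indicator (tri t) z * f t z)"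
    by (intro Bochner_Integration.integral_sum bdd_meas_integrable piecewise_term_bdd_meas[OF assms])
  also have "\<dots> = (\<Sum>t\<in>indices. LINT z|lebesgue. indicator (tri t) z * f t z)"
  proof (intro sum.cong refl)
    fix t assume t: "t \<in> indices"
    have "(LINT z|?M. indicator (tri t) z * f t z) = (LINT z|lebesgue. indicator (Omega L) z *\<^sub>R (indicator (tri t) z * f t z))"
      by (rule integral_restrict_space) simp
    also have "(\<lambda>z. indicator (Omega L) z *\<^sub>R (indicator (tri t) z * f t z)) = (\<lambda>z. indicator (tri t) z * f t z)"
      using tri_subset_Omega[OF t] by (intro ext) (auto split: split_indicator)
    finally show "(LINT z|?M. indicator (tri t) z * f t z) = (LINT z|lebesgue. indicator (tri t) z * f t z)" .
  qed
  finally show ?thesis .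
qed

end

section \<open>Skewness of the discrete advection\<close>

text \<open>The boundary integral of \<open>a\<^sup>2 / 2\<close> times the tangential derivative of \<open>u\<close> along the edge from
  \<open>z\<close> to \<open>z'\<close>, for \<open>u\<close> and \<open>a\<close> affine on the edge.\<close>

definition edge_flux :: "(real \<times> real \<Rightarrow> real) \<Rightarrow> (real \<times> real \<Rightarrow> real) \<Rightarrow> real \<times> real \<Rightarrow> real \<times> real \<Rightarrow> real" where
  "edge_flux u a z z' = (u z' - u z) * ((a z)\<^sup>2 + a z * a z' + (a z')\<^sup>2) / 6"

context fem_grid
begin

lemma mesh_triangle:
  assumes "t \<in> indices"
  shows "convex hull {(xs (ci t), ys (cj t)), (xs (hi t), ys (cj t)), (xs (ci t), ys (vj t))} \<in> triangles n xs ys d"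
proof -
  obtain i j s where ij: "t = (i, j, s)" "i < n - 1" "j < n - 1" using assms by (auto simp: indices_def)
  have "convex hull {(xs (ci t), ys (cj t)), (xs (hi t), ys (cj t)), (xs (ci t), ys (vj t))} \<in> cell_triangles xs ys d i j"
    unfolding ij(1) by (cases "d i j"; cases s) (simp_all add: cell_triangles_def index_defs Let_def insert_commute)
  then show ?thesis using ij unfolding triangles_def by blast
qed

definition "base v t = v (xs (ci t), ys (cj t))"
definition "dh v t = v (xs (hi t), ys (cj t)) - v (xs (ci t), ys (cj t))"
definition "dv v t = v (xs (ci t), ys (vj t)) - v (xs (ci t), ys (cj t))"

abbreviation XN where "XN \<equiv> X_N L (triangles n xs ys d)"
abbreviation XNP where "XNP \<equiv> X_NP L (triangles n xs ys d)"

lemma on_tri: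
  assumes v: "v \<in> XN" and t: "t \<in> indices" and z: "z \<in> tri t"
  shows "v z = base v t + dh v t * ((fst z - xs (ci t)) / leg_x t) + dv v t * ((snd z - ys (cj t)) / leg_y t)"
    and "grad v z = (dh v t / leg_x t, dv v t / leg_y t)"
proof -
  let ?c = "(xs (ci t), ys (cj t))"
  have H: "xs (ci t) + leg_x t = xs (hi t)" "ys (cj t) + leg_y t = ys (vj t)"
    by (simp_all add: leg_x_def leg_y_def)
  obtain a b where "\<forall>z \<in> convex hull {?c, (fst ?c + leg_x t, snd ?c), (fst ?c, snd ?c + leg_y t)}. v z = a + b \<bullet> z"
    using v mesh_triangle[OF t] unfolding X_N_def fst_conv snd_conv H by blast
  note f = grad_formula[OF legs_nonzero[OF t] this z[unfolded tri_def]]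
  show "v z = base v t + dh v t * ((fst z - xs (ci t)) / leg_x t) + dv v t * ((snd z - ys (cj t)) / leg_y t)"
    using f(1) by (simp add: base_def dh_def dv_def H)
  show "grad v z = (dh v t / leg_x t, dv v t / leg_y t)"
    unfolding grad_def f(2) by (simp add: dh_def dv_def H)
qed

lemma piecewise_X_N:
  assumes "v \<in> XN"
  shows "piecewise (\<lambda>t z. base v t + dh v t * ((fst z - xs (ci t)) / leg_x t) + dv v t * ((snd z - ys (cj t)) / leg_y t)) v"
    and "piecewise (\<lambda>t _. dh v t / leg_x t) (\<lambda>z. fst (grad v z))"
    and "piecewise (\<lambda>t _. dv v t / leg_y t) (\<lambda>z. snd (grad v z))"
  unfolding piecewise_def using on_tri[OF assms] legs_nonzero by (auto intro!: continuous_intros)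

lemma bdd_meas_X_N:
  assumes "v \<in> XN"
  shows "bdd_meas v" "bdd_meas (\<lambda>z. fst (grad v z))" "bdd_meas (\<lambda>z. snd (grad v z))"
  using piecewise_X_N[OF assms] piecewise_bdd_meas by blast+

text \<open>Switching \<open>s\<close> reverses both legs, so the sign of their product depends only
  on the diagonal of the cell.\<close>

lemma sgn_legs:
  assumes "i < n - 1" "j < n - 1"
  shows "\<bar>leg_x (i, j, s) * leg_y (i, j, s)\<bar> = (if d i j then -1 else 1) * (leg_x (i, j, s) * leg_y (i, j, s))"
proof -
  have "xs i < xs (Suc i)" "ys j < ys (Suc j)" using assms grid_step grid_xs grid_ys by blast+
  then have "\<bar>leg_x (i, j, s)\<bar> = (if d i j = s then -1 else 1) * leg_x (i, j, s)"
    "\<bar>leg_y (i, j, s)\<bar> = (if s then 1 else -1) * leg_y (i, j, s)"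
    by (auto simp: leg_x_def leg_y_def index_defs)
  then show ?thesis unfolding abs_mult by simp
qed

text \<open>On a triangle both gradients are constant, so the integrand is affine. The area factor
  cancels the leg lengths in the gradients, and only nodal values remain.\<close>

lemma integral_advection:
  assumes u: "u \<in> XN" and a: "a \<in> XN"
  shows "(LINT z|lebesgue_on (Omega L). (rot (grad u z) \<bullet> grad a z) * a z) =
    (\<Sum>(i, j, s)\<in>indices. (if d i j then -1 else 1) *
      (dh u (i, j, s) * dv a (i, j, s) - dv u (i, j, s) * dh a (i, j, s)) * 
      (base a (i, j, s) / 2 + (dh a (i, j, s) + dv a (i, j, s)) / 6))"
proof -
  define J where "J t = (dh u t * dv a t - dv u t * dh a t) / (leg_x t * leg_y t)" for t
  define f where "f t z = J t * base a t + (J t * dh a t) * ((fst z - xs (ci t)) / leg_x t)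
    + (J t * dv a t) * ((snd z - ys (cj t)) / leg_y t)" for t and z :: "real \<times> real"
  have "piecewise f (\<lambda>z. (rot (grad u z) \<bullet> grad a z) * a z)"
    unfolding piecewise_def
  proof (intro ballI conjI)
    fix t assume t: "t \<in> indices"
    show "continuous_on UNIV (f t)" unfolding f_def using legs_nonzero[OF t] by (intro continuous_intros) auto
    fix z assume z: "z \<in> tri t"
    have "rot (grad u z) \<bullet> grad a z = J t"
      unfolding on_tri(2)[OF u t z] on_tri(2)[OF a t z] using legs_nonzero[OF t]
      by (simp add: rot_def J_def divide_simps)
    then show "(rot (grad u z) \<bullet> grad a z) * a z = f t z"
      by (simp only: on_tri(1)[OF a t z] f_def) (simp add: algebra_simps)
  qed
  then have "(LINT z|lebesgue_on (Omega L). (rot (grad u z) \<bullet> grad a z) * a z) =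
      (\<Sum>t\<in>indices. LINT z|lebesgue. indicator (tri t) z * f t z)"
    by (rule integral_piecewise)
  also have "\<dots> = (\<Sum>(i, j, s)\<in>indices. (if d i j then -1 else 1) *
      (dh u (i, j, s) * dv a (i, j, s) - dv u (i, j, s) * dh a (i, j, s)) * 
      (base a (i, j, s) / 2 + (dh a (i, j, s) + dv a (i, j, s)) / 6))"
  proof (intro sum.cong refl, safe)
    fix i j s assume t: "(i, j, s) \<in> indices"
    let ?t = "(i, j, s)"
    have ij: "i < n - 1" "j < n - 1" using t by (auto simp: indices_def)
    have "(LINT z|lebesgue. indicator (tri ?t) z * f ?t z) =
      \<bar>leg_x ?t * leg_y ?t\<bar> * (J ?t * base a ?t / 2 + (J ?t * dh a ?t + J ?t * dv a ?t) / 6)"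
      unfolding tri_def f_def
      using integral_right_triangle[OF legs_nonzero[OF t], of "(xs (ci ?t), ys (cj ?t))"] by simp
    also have "\<dots> = (if d i j then -1 else 1) * (leg_x ?t * leg_y ?t * J ?t) *
        (base a ?t / 2 + (dh a ?t + dv a ?t) / 6)"
      unfolding sgn_legs[OF ij] by (simp add: algebra_simps add_divide_distrib)
    also have "leg_x ?t * leg_y ?t * J ?t = dh u ?t * dv a ?t - dv u ?t * dh a ?t"
      using legs_nonzero[OF t] by (simp add: J_def)
    finally show "(LINT z|lebesgue. indicator (tri ?t) z * f ?t z) = (if d i j then -1 else 1) *
      (dh u ?t * dv a ?t - dv u ?t * dh a ?t) * (base a ?t / 2 + (dh a ?t + dv a ?t) / 6)" .
  qed
  finally show ?thesis .
qed

lemma advection_skew: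
  assumes u: "u \<in> XNP" and a: "a \<in> XNP"
  shows "(LINT z|lebesgue_on (Omega L). (rot (grad u z) \<bullet> grad a z) * a z) = 0"
proof -
  define N where "N = n - 1"
  define H where "H i j = edge_flux u a (xs i, ys j) (xs (Suc i), ys j)" for i j
  define V where "V i j = edge_flux u a (xs i, ys j) (xs i, ys (Suc j))" for i j
  define F where "F = (\<lambda>(i, j, s). (if d i j then -1 else 1) *
      (dh u (i, j, s) * dv a (i, j, s) - dv u (i, j, s) * dh a (i, j, s)) * 
      (base a (i, j, s) / 2 + (dh a (i, j, s) + dv a (i, j, s)) / 6))"
  have XN: "u \<in> XN" "a \<in> XN" using u a by (auto simp: X_NP_def)
  \<comment> \<open>A polynomial identity in the corner values. The two triangles run through their
    common diagonal in opposite directions, so only the four sides of the cell survive, taken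
    clockwise.\<close>
  have cell: "F (i, j, True) + F (i, j, False) = (H i (Suc j) - H i j) - (V (Suc i) j - V i j)" for i j
    by (cases "d i j") (simp_all add: F_def H_def V_def edge_flux_def dh_def dv_def base_def index_defs
        power2_eq_square field_simps)
  have per: "v (xs i, ys N) = v (xs i, ys 0) \<and> v (xs N, ys i) = v (xs 0, ys i)"
    if "v \<in> XNP" "i < n" for v i
    using that grid_bounds[OF grid_xs, of i] grid_bounds[OF grid_ys, of i] grid_xs grid_ys
    by (auto simp: X_NP_def grid_def N_def)
  have "(LINT z|lebesgue_on (Omega L). (rot (grad u z) \<bullet> grad a z) * a z) = sum F indices"
    unfolding integral_advection[OF XN] F_def ..
  also have "\<dots> = (\<Sum>i<N. \<Sum>j<N. F (i, j, True) + F (i, j, False))"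
    unfolding indices_def N_def by (simp add: sum.cartesian_product' UNIV_bool add.commute)
  also have "\<dots> = (\<Sum>i<N. \<Sum>j<N. H i (Suc j) - H i j) - (\<Sum>i<N. \<Sum>j<N. V (Suc i) j - V i j)"
    unfolding cell by (simp only: sum_subtractf)
  also have "(\<Sum>i<N. \<Sum>j<N. V (Suc i) j - V i j) = (\<Sum>j<N. \<Sum>i<N. V (Suc i) j - V i j)"
    by (rule sum.swap)
  also have "(\<Sum>i<N. \<Sum>j<N. H i (Suc j) - H i j) - (\<Sum>j<N. \<Sum>i<N. V (Suc i) j - V i j) =
      (\<Sum>i<N. H i N - H i 0) - (\<Sum>j<N. V N j - V 0 j)"
    by (simp only: sum_lessThan_telescope sum_lessThan_telescope[of "\<lambda>i. V i _"])
  \<comment> \<open>After telescoping only the outer boundary is left. Periodicity at both ends of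
    an edge, \<open>i\<close> and \<open>Suc i\<close>, gives opposite boundary edges the same
    flux.\<close>
  also have "\<dots> = 0"
  proof -
    have "H i N = H i 0" "V N i = V 0 i" if "i < N" for i
      using that per[OF u, of i] per[OF u, of "Suc i"] per[OF a, of i] per[OF a, of "Suc i"]
      by (auto simp: H_def V_def edge_flux_def N_def)
    then show ?thesis by simp
  qed
  finally show ?thesis .
qed

section \<open>Bounds for the discrete operators\<close>

lemma AE_in_tri: "AE z in lebesgue_on (Omega L). \<exists>t\<in>indices. z \<in> tri t"
  using AE_partition
proof eventually_elim
  case (elim z)
  show ?case
  proof (rule ccontr)
    assume "\<not> ?case"
    then have "(\<Sum>t\<in>indices. indicator (tri t) z) = (0 :: real)" by (intro sum.neutral) auto
    with elim show False by simp
  qed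
qed

lemma L_pos: "0 < L"
proof -
  have "xs 0 < xs (n - 1)" by (rule strict_mono_onD[of "{..<n}" xs]) (use grid_xs in \<open>auto simp: grid_def\<close>)
  then show ?thesis using grid_xs by (simp add: grid_def)
qed

lemma bdd_meas_grad_inner:
  assumes "u \<in> XN" "a \<in> XN"
  shows "bdd_meas (\<lambda>z. grad u z \<bullet> grad a z)" "bdd_meas (\<lambda>z. rot (grad u z) \<bullet> grad a z)"
  unfolding inner_prod_def rot_def fst_conv snd_conv inner_real_def
  by (intro bdd_meas_intros bdd_meas_X_N assms)+

lemma bdd_meas_integral_Cauchy_Schwarz:
  assumes "bdd_meas f" "bdd_meas g"
  shows "(LINT z|lebesgue_on (Omega L). f z * g z)\<^sup>2 \<le>
    (LINT z|lebesgue_on (Omega L). (f z)\<^sup>2) * (LINT z|lebesgue_on (Omega L). (g z)\<^sup>2)"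
  using L2_Cauchy_Schwarz[of "lebesgue_on (Omega L)" f g] assms
  by (simp add: power2_eq_square bdd_meas_integrable bdd_meas_mult)

text \<open>Hoelder with exponents 4, 4, 2 through two uses of Cauchy-Schwarz: one splits off
  \<open>w\<close>, the other separates the two gradients. Rotation preserves length.\<close>

lemma advection_Hoelder:
  assumes u: "u \<in> XN" and a: "a \<in> XN" and w: "w \<in> XN"
  shows "\<bar>LINT z|lebesgue_on (Omega L). (rot (grad u z) \<bullet> grad a z) * w z\<bar> \<le>
    seminorm14 L u * seminorm14 L a * norm2 L w"
proof -
  let ?I = "\<lambda>f. LINT z|lebesgue_on (Omega L). f z"
  let ?A = "?I (\<lambda>z. norm (grad u z) ^ 4)" and ?B = "?I (\<lambda>z. norm (grad a z) ^ 4)"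
  have nn: "norm (grad v z) ^ 4 = (grad v z \<bullet> grad v z)\<^sup>2" for v z
    by (simp add: power2_norm_eq_inner[symmetric])
  have nonneg: "0 \<le> ?A" "0 \<le> ?B" "0 \<le> ?I (\<lambda>z. (w z)\<^sup>2)" by simp_all
  have "?I (\<lambda>z. (rot (grad u z) \<bullet> grad a z)\<^sup>2) \<le> ?I (\<lambda>z. (grad u z \<bullet> grad u z) * (grad a z \<bullet> grad a z))"
  proof (intro integral_mono bdd_meas_integrable bdd_meas_intros bdd_meas_grad_inner u a)
    fix z
    have "(rot (grad u z) \<bullet> grad a z)\<^sup>2 \<le> (rot (grad u z) \<bullet> rot (grad u z)) * (grad a z \<bullet> grad a z)"
      by (rule Cauchy_Schwarz_ineq)
    also have "rot (grad u z) \<bullet> rot (grad u z) = grad u z \<bullet> grad u z"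
      by (simp add: rot_def inner_prod_def)
    finally show "(rot (grad u z) \<bullet> grad a z)\<^sup>2 \<le> (grad u z \<bullet> grad u z) * (grad a z \<bullet> grad a z)" .
  qed
  moreover have "(?I (\<lambda>z. (grad u z \<bullet> grad u z) * (grad a z \<bullet> grad a z)))\<^sup>2 \<le> ?A * ?B"
    unfolding nn by (intro bdd_meas_integral_Cauchy_Schwarz bdd_meas_grad_inner u a)
  then have "?I (\<lambda>z. (grad u z \<bullet> grad u z) * (grad a z \<bullet> grad a z)) \<le> sqrt (?A * ?B)"
    by (rule real_le_rsqrt)
  ultimately have "?I (\<lambda>z. (rot (grad u z) \<bullet> grad a z)\<^sup>2) \<le> sqrt (?A * ?B)" by linarith
  then have "?I (\<lambda>z. (rot (grad u z) \<bullet> grad a z)\<^sup>2) * ?I (\<lambda>z. (w z)\<^sup>2) \<le> sqrt (?A * ?B) * ?I (\<lambda>z. (w z)\<^sup>2)"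
    by (rule mult_right_mono) simp
  moreover have "(?I (\<lambda>z. (rot (grad u z) \<bullet> grad a z) * w z))\<^sup>2 \<le>
      ?I (\<lambda>z. (rot (grad u z) \<bullet> grad a z)\<^sup>2) * ?I (\<lambda>z. (w z)\<^sup>2)"
    by (intro bdd_meas_integral_Cauchy_Schwarz bdd_meas_grad_inner bdd_meas_X_N u a w)
  ultimately have "(?I (\<lambda>z. (rot (grad u z) \<bullet> grad a z) * w z))\<^sup>2 \<le> sqrt (?A * ?B) * ?I (\<lambda>z. (w z)\<^sup>2)"
    by linarith
  also have "\<dots> = (seminorm14 L u * seminorm14 L a * norm2 L w)\<^sup>2"
  proof -
    have "(x powr (1 / 4))\<^sup>2 = sqrt x" if "0 \<le> x" for x :: real
      using that by (cases "x = 0") (simp_all add: powr_half_sqrt[symmetric] powr_power)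
    then show ?thesis
      using nonneg by (simp add: seminorm14_def norm2_def ip2_def power_mult_distrib real_sqrt_mult
          power2_eq_square[of "w _", symmetric])
  qed
  finally show ?thesis
    by (intro power2_le_imp_le[of "\<bar>_\<bar>"])
      (auto simp: seminorm14_def norm2_def ip2_def)
qed

text \<open>Cauchy-Schwarz with \<open>grad u\<close> alone on one side, so that the advection is
  controlled by the L2 norm of the gradient of the stream. This is the source of
  \<open>S_bound_gr\<close>.\<close>

lemma advection_weighted_bound:
  assumes u: "u \<in> XN" and a: "a \<in> XN" and w: "w \<in> XN"
  shows "(LINT z|lebesgue_on (Omega L). (rot (grad u z) \<bullet> grad a z) * w z)\<^sup>2 \<le>
    (LINT z|lebesgue_on (Omega L). grad u z \<bullet> grad u z) *
    (LINT z|lebesgue_on (Omega L). (grad a z \<bullet> grad a z) * (w z)\<^sup>2)"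
proof -
  have "rot x \<bullet> rot x = x \<bullet> x" for x by (simp add: rot_def inner_prod_def)
  then show ?thesis
    using L2_Cauchy_Schwarz[of "lebesgue_on (Omega L)" "\<lambda>z. rot (grad u z)" "\<lambda>z. w z *\<^sub>R grad a z"]
      bdd_meas_integrable[OF bdd_meas_grad_inner(1)[OF u u]]
      bdd_meas_integrable[OF bdd_meas_mult[OF bdd_meas_grad_inner(2)[OF u a] bdd_meas_X_N(1)[OF w]]]
      bdd_meas_integrable[OF bdd_meas_mult[OF bdd_meas_grad_inner(1)[OF a a] bdd_meas_power[OF bdd_meas_X_N(1)[OF w], of 2]]]
    by (simp add: power2_eq_square mult_ac)
qed

lemma transport_bound:
  assumes u: "u \<in> XN" and a: "a \<in> XN"
    and p: "bdd_meas px" "bdd_meas py"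
    and P: "AE z in lebesgue_on (Omega L). \<bar>px z\<bar> \<le> P \<and> \<bar>py z\<bar> \<le> P" "0 \<le> P"
  shows "\<bar>LINT z|lebesgue_on (Omega L). (rot (px z, py z) \<bullet> grad u z) * a z\<bar> \<le>
    2 * P * sqrt (LINT z|lebesgue_on (Omega L). grad u z \<bullet> grad u z) * norm2 L a"
proof -
  let ?I = "\<lambda>f. LINT z|lebesgue_on (Omega L). f z"
  have bm: "bdd_meas (\<lambda>z. rot (px z, py z) \<bullet> grad u z)"
    unfolding inner_prod_def rot_def fst_conv snd_conv inner_real_def
    by (intro bdd_meas_intros bdd_meas_X_N u p)
  have "?I (\<lambda>z. (rot (px z, py z) \<bullet> grad u z)\<^sup>2) \<le> ?I (\<lambda>z. (2 * P)\<^sup>2 * (grad u z \<bullet> grad u z))"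
  proof (intro integral_mono_AE bdd_meas_integrable bdd_meas_intros bdd_meas_grad_inner u bm)
    from P(1) show "AE z in lebesgue_on (Omega L). (rot (px z, py z) \<bullet> grad u z)\<^sup>2 \<le> (2 * P)\<^sup>2 * (grad u z \<bullet> grad u z)"
    proof eventually_elim
      case (elim z)
      have "(px z)\<^sup>2 \<le> P\<^sup>2" "(py z)\<^sup>2 \<le> P\<^sup>2" using elim P(2) by (simp_all add: abs_le_square_iff[symmetric])
      moreover have "rot (px z, py z) \<bullet> rot (px z, py z) = (px z)\<^sup>2 + (py z)\<^sup>2"
        by (simp add: rot_def power2_eq_square)
      moreover have "(2 * P)\<^sup>2 = 4 * P\<^sup>2" by (simp add: power_mult_distrib)
      \<comment> \<open>The squared length is at most twice \<open>P\<close> squared; rounding it up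
        gives the constant of \<open>R_bound\<close>.\<close>
      ultimately have "rot (px z, py z) \<bullet> rot (px z, py z) \<le> (2 * P)\<^sup>2"
        using zero_le_power2[of P] by linarith
      then have "(rot (px z, py z) \<bullet> rot (px z, py z)) * (grad u z \<bullet> grad u z) \<le> (2 * P)\<^sup>2 * (grad u z \<bullet> grad u z)"
        by (rule mult_right_mono) simp
      then show ?case using Cauchy_Schwarz_ineq[of "rot (px z, py z)" "grad u z"] by linarith
    qed
  qed
  also have "\<dots> = (2 * P)\<^sup>2 * ?I (\<lambda>z. grad u z \<bullet> grad u z)" by simp
  finally have "?I (\<lambda>z. (rot (px z, py z) \<bullet> grad u z)\<^sup>2) * ?I (\<lambda>z. (a z)\<^sup>2) \<le>
      (2 * P)\<^sup>2 * ?I (\<lambda>z. grad u z \<bullet> grad u z) * ?I (\<lambda>z. (a z)\<^sup>2)"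
    by (rule mult_right_mono) simp
  then have "(?I (\<lambda>z. (rot (px z, py z) \<bullet> grad u z) * a z))\<^sup>2 \<le>
      (2 * P)\<^sup>2 * ?I (\<lambda>z. grad u z \<bullet> grad u z) * ?I (\<lambda>z. (a z)\<^sup>2)"
    using bdd_meas_integral_Cauchy_Schwarz[OF bm bdd_meas_X_N(1)[OF a]] by linarith
  also have "\<dots> = (2 * P * sqrt (?I (\<lambda>z. grad u z \<bullet> grad u z)) * norm2 L a)\<^sup>2"
    by (simp add: norm2_def ip2_def power_mult_distrib power2_eq_square[of "a _", symmetric])
  finally show ?thesis
    by (intro power2_le_imp_le[of "\<bar>_\<bar>"]) (use P(2) in \<open>auto simp: norm2_def ip2_def\<close>)
qed

end

section \<open>Finite element functions and the matrices as bilinear forms\<close>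

locale fem_space = fem_grid L n xs ys d
  for L :: real and n :: nat and xs ys :: "nat \<Rightarrow> real" and d :: "nat \<Rightarrow> nat \<Rightarrow> bool" +
  fixes node :: "'n::finite \<Rightarrow> nat \<times> nat" and \<phi> :: "'n \<Rightarrow> real \<times> real \<Rightarrow> real"
  assumes basis: "nodal_basis L n xs ys d node \<phi>"
begin

lemma phi_X_NP: "\<phi> I \<in> XNP"
  using basis by (simp add: nodal_basis_def)

lemma phi_X_N: "\<phi> I \<in> XN"
  using phi_X_NP by (simp add: X_NP_def)

lemma fe_X_N: "fe \<phi> U \<in> XN"
  unfolding X_N_def
proof (intro CollectI conjI ballI allI impI)
  show "continuous_on (Omega_bar L) (fe \<phi> U)"
    using phi_X_N unfolding fe_def X_N_def by (intro continuous_intros) auto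
  fix T assume "T \<in> triangles n xs ys d"
  then have "\<exists>a b. \<forall>z\<in>T. \<phi> I z = a + b \<bullet> z" for I
    using phi_X_N[of I] by (simp add: X_N_def)
  then obtain a b where ab: "\<And>I z. z \<in> T \<Longrightarrow> \<phi> I z = a I + b I \<bullet> z" by metis
  have "fe \<phi> U z = (\<Sum>I\<in>UNIV. U $ I * a I) + (\<Sum>I\<in>UNIV. U $ I *\<^sub>R b I) \<bullet> z" if "z \<in> T" for z
    by (simp add: fe_def ab[OF that] inner_sum_left distrib_left sum.distrib)
  then show "\<exists>a b. \<forall>z\<in>T. fe \<phi> U z = a + b \<bullet> z" by blast
next
  fix z assume "z \<notin> Omega_bar L"
  then have "\<phi> I z = 0" for I using phi_X_N[of I] unfolding X_N_def by blast
  then show "fe \<phi> U z = 0" by (simp add: fe_def)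
qed

lemma fe_X_NP: "fe \<phi> U \<in> XNP"
  using fe_X_N phi_X_NP by (auto simp: X_NP_def fe_def)

lemma fe_diff: "fe \<phi> (U - V) z = fe \<phi> U z - fe \<phi> V z"
  by (simp add: fe_def left_diff_distrib sum_subtractf)

text \<open>Linearity of the classical gradient holds inside the triangles; on the edges the basis
  functions need not be differentiable.\<close>

lemma grad_fe: "AE z in lebesgue_on (Omega L). grad (fe \<phi> U) z = (\<Sum>I\<in>UNIV. U $ I *\<^sub>R grad (\<phi> I) z)"
  using AE_in_tri
proof eventually_elim
  case (elim z)
  then obtain t where t: "t \<in> indices" "z \<in> tri t" by blast
  have "dh (fe \<phi> U) t = (\<Sum>I\<in>UNIV. U $ I * dh (\<phi> I) t)" "dv (fe \<phi> U) t = (\<Sum>I\<in>UNIV. U $ I * dv (\<phi> I) t)"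
    by (simp_all add: dh_def dv_def fe_def right_diff_distrib sum_subtractf)
  then show ?case
    by (simp add: on_tri(2)[OF fe_X_N t] on_tri(2)[OF phi_X_N t] sum_prod sum_divide_distrib)
qed

lemma bilinear_integral:
  assumes "\<And>I J. bdd_meas (F I J)"
  shows "a \<bullet> ((\<chi> I J. LINT z|lebesgue_on (Omega L). F I J z) *v b) =
    (LINT z|lebesgue_on (Omega L). (\<Sum>I\<in>UNIV. \<Sum>J\<in>UNIV. a $ I * b $ J * F I J z))"
proof -
  have "(LINT z|lebesgue_on (Omega L). (\<Sum>I\<in>UNIV. \<Sum>J\<in>UNIV. a $ I * b $ J * F I J z)) =
      (\<Sum>I\<in>UNIV. \<Sum>J\<in>UNIV. a $ I * b $ J * (LINT z|lebesgue_on (Omega L). F I J z))"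
    by (simp add: Bochner_Integration.integral_sum bdd_meas_integrable bdd_meas_intros assms)
  then show ?thesis
    by (simp add: inner_vec_def matrix_vector_mult_def sum_distrib_left mult_ac)
qed

text \<open>Common route from matrix entries to integrals of finite element functions: the double
  sum moves under the integral, where \<open>G\<close> may differ from it on the edges.\<close>

lemma bilinear_integral_AE:
  assumes "\<And>I J. bdd_meas (F I J)" and "bdd_meas G"
    and "AE z in lebesgue_on (Omega L). (\<Sum>I\<in>UNIV. \<Sum>J\<in>UNIV. a $ I * b $ J * F I J z) = G z"
  shows "a \<bullet> ((\<chi> I J. LINT z|lebesgue_on (Omega L). F I J z) *v b) = (LINT z|lebesgue_on (Omega L). G z)"
  unfolding bilinear_integral[OF assms(1)]
  by (intro integral_cong_AE bdd_meas_measurable bdd_meas_intros assms)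

lemma matM_form: "a \<bullet> (matM L \<phi> *v b) = ip2 L (fe \<phi> a) (fe \<phi> b)"
  unfolding matM_def ip2_def
  by (intro bilinear_integral_AE bdd_meas_intros bdd_meas_X_N phi_X_N fe_X_N)
    (simp add: fe_def sum_product mult_ac)

definition "energy a = (LINT z|lebesgue_on (Omega L). grad (fe \<phi> a) z \<bullet> grad (fe \<phi> a) z)"

lemma energy_nonneg: "0 \<le> energy a"
  by (simp add: energy_def)

lemma matK_form: "a \<bullet> (matK L \<phi> *v a) = a \<bullet> (matM L \<phi> *v a) + energy a"
proof -
  have K: "matK L \<phi> = matM L \<phi> + (\<chi> I J. LINT z|lebesgue_on (Omega L). grad (\<phi> I) z \<bullet> grad (\<phi> J) z)"
    by (simp add: vec_eq_iff matK_def matM_def ipH1_def)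
  have "a \<bullet> ((\<chi> I J. LINT z|lebesgue_on (Omega L). grad (\<phi> I) z \<bullet> grad (\<phi> J) z) *v a) = energy a"
    unfolding energy_def
  proof (intro bilinear_integral_AE bdd_meas_grad_inner phi_X_N fe_X_N)
    show "AE z in lebesgue_on (Omega L). (\<Sum>I\<in>UNIV. \<Sum>J\<in>UNIV. a $ I * a $ J * (grad (\<phi> I) z \<bullet> grad (\<phi> J) z)) =
        grad (fe \<phi> a) z \<bullet> grad (fe \<phi> a) z"
      using grad_fe[of a] by eventually_elim (simp add: inner_sum_left inner_sum_right sum_distrib_left inner_commute mult_ac)
  qed
  then show ?thesis unfolding K by (simp add: matrix_vector_mult_add_rdistrib inner_add_right)
qed

lemma matS_form:
  "a \<bullet> (matS L \<phi> u *v b) = - (LINT z|lebesgue_on (Omega L). (rot (grad (fe \<phi> u) z) \<bullet> grad (fe \<phi> a) z) * fe \<phi> b z)"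
proof -
  have S: "matS L \<phi> u = (\<chi> I J. LINT z|lebesgue_on (Omega L). - ((rot (grad (fe \<phi> u) z) \<bullet> grad (\<phi> I) z) * \<phi> J z))"
    by (simp add: matS_def ip2_def)
  have "a \<bullet> (matS L \<phi> u *v b) = (LINT z|lebesgue_on (Omega L). - ((rot (grad (fe \<phi> u) z) \<bullet> grad (fe \<phi> a) z) * fe \<phi> b z))"
    unfolding S
  proof (intro bilinear_integral_AE bdd_meas_intros bdd_meas_grad_inner bdd_meas_X_N phi_X_N fe_X_N)
    show "AE z in lebesgue_on (Omega L).
        (\<Sum>I\<in>UNIV. \<Sum>J\<in>UNIV. a $ I * b $ J * - ((rot (grad (fe \<phi> u) z) \<bullet> grad (\<phi> I) z) * \<phi> J z)) =
        - ((rot (grad (fe \<phi> u) z) \<bullet> grad (fe \<phi> a) z) * fe \<phi> b z)"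
      using grad_fe[of a]
      by eventually_elim (simp add: fe_def inner_sum_right sum_product sum_negf mult_ac, rule sum.swap)
  qed
  then show ?thesis by simp
qed

lemma matR_form:
  assumes "bdd_meas px" "bdd_meas py"
  shows "a \<bullet> (matR L \<phi> px py *v b) = (LINT z|lebesgue_on (Omega L). (rot (px z, py z) \<bullet> grad (fe \<phi> b) z) * fe \<phi> a z)"
proof -
  have bm: "bdd_meas (\<lambda>z. rot (px z, py z) \<bullet> grad u z)" if "u \<in> XN" for u
    unfolding inner_prod_def rot_def fst_conv snd_conv inner_real_def
    by (intro bdd_meas_intros bdd_meas_X_N that assms)
  show ?thesis
    unfolding matR_def ip2_def
  proof (intro bilinear_integral_AE bdd_meas_mult bm bdd_meas_X_N phi_X_N fe_X_N)
    show "AE z in lebesgue_on (Omega L).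
        (\<Sum>I\<in>UNIV. \<Sum>J\<in>UNIV. a $ I * b $ J * (rot (px z, py z) \<bullet> grad (\<phi> J) z * \<phi> I z)) =
        (rot (px z, py z) \<bullet> grad (fe \<phi> b) z) * fe \<phi> a z"
      using grad_fe[of b]
    proof eventually_elim
      case (elim z)
      show ?case unfolding elim
        by (simp add: fe_def inner_sum_right sum_product mult_ac)
    qed
  qed
qed

lemma matS_diff: "matS L \<phi> (u - v) = matS L \<phi> u - matS L \<phi> v"
proof -
  have "ip2 L (\<lambda>z. rot (grad (fe \<phi> (u - v)) z) \<bullet> grad (\<phi> I) z) (\<phi> J) =
      ip2 L (\<lambda>z. rot (grad (fe \<phi> u) z) \<bullet> grad (\<phi> I) z) (\<phi> J) - ip2 L (\<lambda>z. rot (grad (fe \<phi> v) z) \<bullet> grad (\<phi> I) z) (\<phi> J)"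
    for I J
  proof -
    let ?f = "\<lambda>u z. rot (grad (fe \<phi> u) z) \<bullet> grad (\<phi> I) z * \<phi> J z"
    have bm: "bdd_meas (?f u)" for u
      by (intro bdd_meas_mult bdd_meas_grad_inner bdd_meas_X_N phi_X_N fe_X_N)
    have "(LINT z|lebesgue_on (Omega L). ?f (u - v) z) = (LINT z|lebesgue_on (Omega L). ?f u z - ?f v z)"
    proof (intro integral_cong_AE bdd_meas_measurable bdd_meas_diff bm)
      show "AE z in lebesgue_on (Omega L). ?f (u - v) z = ?f u z - ?f v z"
        using grad_fe[of u] grad_fe[of v] grad_fe[of "u - v"]
      proof eventually_elim
        case (elim z)
        have "grad (fe \<phi> (u - v)) z = grad (fe \<phi> u) z - grad (fe \<phi> v) z"
          by (simp add: elim scaleR_diff_left sum_subtractf)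
        then show ?case by (simp only:) (simp add: rot_def inner_prod_def algebra_simps)
      qed
    qed
    then show ?thesis unfolding ip2_def using bm by (simp add: bdd_meas_integrable)
  qed
  then show ?thesis by (simp add: matS_def vec_eq_iff)
qed

lemma fe_node: "fe \<phi> U (xs (fst (node I)), ys (snd (node I))) = U $ I"
  using basis by (simp add: fe_def nodal_basis_def if_distrib[of "\<lambda>x. _ * x"] cong: if_cong)

text \<open>If the integral of the square vanishes, the function is zero almost everywhere. By
  continuity the set where it is nonzero is open, and an open null set is empty.\<close>

lemma matM_pos:
  assumes "a \<noteq> 0"
  shows "0 < a \<bullet> (matM L \<phi> *v a)"
proof (rule ccontr)
  let ?f = "fe \<phi> a"
  assume "\<not> ?thesis"
  then have "(LINT z|lebesgue_on (Omega L). (?f z)\<^sup>2) = 0"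
    by (metis (mono_tags, lifting) Bochner_Integration.integral_nonneg antisym_conv ip2_def matM_form not_less
        power2_eq_square zero_le_power2 Bochner_Integration.integral_cong)
  moreover have "integrable (lebesgue_on (Omega L)) (\<lambda>z. (?f z)\<^sup>2)"
    by (intro bdd_meas_integrable bdd_meas_power bdd_meas_X_N fe_X_N)
  ultimately have "AE z in lebesgue_on (Omega L). (?f z)\<^sup>2 = 0"
    by (subst (asm) integral_nonneg_eq_0_iff_AE) auto
  then have ae: "AE z in lebesgue. \<not> (z \<in> Omega L \<and> ?f z \<noteq> 0)"
    by (subst (asm) AE_restrict_space_iff) (auto elim: eventually_mono)
  have cont: "continuous_on (Omega_bar L) ?f" using fe_X_N by (simp add: X_N_def)
  have "open (Omega L)" by (simp add: Omega_def open_Times)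
  moreover have "continuous_on (Omega L) ?f"
    using cont by (rule continuous_on_subset) (auto simp: Omega_def Omega_bar_def)
  ultimately have op: "open {z \<in> Omega L. ?f z \<noteq> 0}"
    using continuous_open_preimage[of "Omega L" ?f "- {0}"] by (simp add: vimage_def Int_def open_Compl)
  then have "{z \<in> Omega L. ?f z \<noteq> 0} \<in> sets lebesgue" by (simp add: borel_open)
  then have "negligible {z \<in> Omega L. ?f z \<noteq> 0}"
    unfolding negligible_iff_null_sets by (subst AE_iff_null_sets) (use ae in simp_all)
  then have zero: "\<forall>z\<in>Omega L. ?f z = 0"
    using open_not_negligible[OF op] by blast
  \<comment> \<open>Grid points with an index 0 lie on the boundary, so the zero is carried to the
    closed square before the coefficients are read off.\<close>
  have "closure (Omega L) = Omega_bar L"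
    using L_pos by (simp add: Omega_def Omega_bar_def closure_Times)
  then have "?f z = 0" if "z \<in> Omega_bar L" for z
    using that zero cont continuous_constant_on_closure[of "Omega L" ?f 0 z] by simp
  moreover have "(xs (fst (node I)), ys (snd (node I))) \<in> Omega_bar L" for I
  proof -
    have "node I \<in> {..<n - 1} \<times> {..<n - 1}" using basis by (auto simp: nodal_basis_def dest: bij_betwE)
    then show ?thesis using grid_bounds[OF grid_xs] grid_bounds[OF grid_ys] by (auto simp: Omega_bar_def mem_Times_iff)
  qed
  ultimately have "a $ I = 0" for I using fe_node[of a I] by metis
  with assms show False by (simp add: vec_eq_iff)
qed

text \<open>Cauchy-Schwarz in the coefficients bounds both factors pointwise by basis functions. The
  constant depends on the mesh; the convergence argument only asks that it be finite.\<close>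

lemma grad_fe_bound:
  obtains C where "0 \<le> C" "\<And>a w. (LINT z|lebesgue_on (Omega L). (grad (fe \<phi> a) z \<bullet> grad (fe \<phi> a) z) * (fe \<phi> w z)\<^sup>2)
      \<le> C * (norm a)\<^sup>2 * (norm w)\<^sup>2"
proof -
  define Q where "Q z = (\<Sum>I\<in>UNIV. grad (\<phi> I) z \<bullet> grad (\<phi> I) z) * (\<Sum>I\<in>UNIV. (\<phi> I z)\<^sup>2)" for z
  define C where "C = (LINT z|lebesgue_on (Omega L). Q z)"
  have CS: "(\<Sum>I\<in>UNIV. a $ I * f I)\<^sup>2 \<le> (norm a)\<^sup>2 * (\<Sum>I\<in>UNIV. (f I)\<^sup>2)" for a :: "real^'n" and f
    using Cauchy_Schwarz_ineq_sum[of "\<lambda>I. a $ I" f UNIV]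
    unfolding power2_norm_eq_inner[of a] inner_vec_def by (simp add: power2_eq_square)
  have bmQ: "bdd_meas Q" unfolding Q_def by (intro bdd_meas_intros bdd_meas_grad_inner bdd_meas_X_N phi_X_N)
  have "0 \<le> C" unfolding C_def Q_def by (intro Bochner_Integration.integral_nonneg mult_nonneg_nonneg sum_nonneg) auto
  moreover have "(LINT z|lebesgue_on (Omega L). (grad (fe \<phi> a) z \<bullet> grad (fe \<phi> a) z) * (fe \<phi> w z)\<^sup>2)
      \<le> C * (norm a)\<^sup>2 * (norm w)\<^sup>2" for a w
  proof -
    have "(LINT z|lebesgue_on (Omega L). (grad (fe \<phi> a) z \<bullet> grad (fe \<phi> a) z) * (fe \<phi> w z)\<^sup>2)
      \<le> (LINT z|lebesgue_on (Omega L). (norm a)\<^sup>2 * (norm w)\<^sup>2 * Q z)"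
    proof (intro integral_mono_AE bdd_meas_integrable bmQ bdd_meas_intros bdd_meas_grad_inner bdd_meas_X_N fe_X_N)
      show "AE z in lebesgue_on (Omega L). (grad (fe \<phi> a) z \<bullet> grad (fe \<phi> a) z) * (fe \<phi> w z)\<^sup>2 \<le> (norm a)\<^sup>2 * (norm w)\<^sup>2 * Q z"
        using grad_fe[of a]
      proof eventually_elim
        case (elim z)
        have "grad (fe \<phi> a) z \<bullet> grad (fe \<phi> a) z =
            (\<Sum>I\<in>UNIV. a $ I * fst (grad (\<phi> I) z))\<^sup>2 + (\<Sum>I\<in>UNIV. a $ I * snd (grad (\<phi> I) z))\<^sup>2"
          unfolding elim by (simp add: inner_prod_def fst_sum snd_sum power2_eq_square)
        also have "\<dots> \<le> (norm a)\<^sup>2 * (\<Sum>I\<in>UNIV. grad (\<phi> I) z \<bullet> grad (\<phi> I) z)"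
          using CS[of a "\<lambda>I. fst (grad (\<phi> I) z)"] CS[of a "\<lambda>I. snd (grad (\<phi> I) z)"]
          by (simp add: inner_prod_def sum.distrib distrib_left power2_eq_square)
        finally have "(grad (fe \<phi> a) z \<bullet> grad (fe \<phi> a) z) * (fe \<phi> w z)\<^sup>2 \<le>
            ((norm a)\<^sup>2 * (\<Sum>I\<in>UNIV. grad (\<phi> I) z \<bullet> grad (\<phi> I) z)) * ((norm w)\<^sup>2 * (\<Sum>I\<in>UNIV. (\<phi> I z)\<^sup>2))"
          using CS[of w "\<lambda>I. \<phi> I z"] unfolding fe_def
          by (intro mult_mono) (auto intro!: mult_nonneg_nonneg sum_nonneg)
        then show ?case by (simp add: Q_def mult_ac)
      qed
    qed
    then show ?thesis by (simp add: C_def mult_ac)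
  qed
  ultimately show ?thesis using that by blast
qed

end

section \<open>Convergence\<close>

text \<open>The diameter of a triangle is at least the length of one of its legs.\<close>

lemma (in fem_grid) mesh_size_pos: "0 < mesh_size (triangles n xs ys d)"
proof -
  have t: "(0, 0, True) \<in> indices" using grid_xs by (auto simp: indices_def grid_def)
  let ?t = "(0, 0, True)"
  let ?p = "(xs (ci ?t), ys (cj ?t))" and ?q = "(xs (hi ?t), ys (cj ?t))" and ?r = "(xs (ci ?t), ys (vj ?t))"
  let ?T = "convex hull {?p, ?q, ?r}"
  have "finite (triangles n xs ys d)"
    unfolding triangles_def by (intro finite_UN_I finite_lessThan) (auto simp: cell_triangles_def Let_def)
  then have "diameter ?T \<le> mesh_size (triangles n xs ys d)"
    unfolding mesh_size_def using mesh_triangle[OF t] by (intro Max_ge) auto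
  moreover have "dist ?p ?q \<le> diameter ?T"
  proof (rule diameter_bounded_bound)
    show "bounded ?T" by (intro bounded_convex_hull finite_imp_bounded) simp
  qed (auto intro: hull_inc)
  moreover have "0 < dist ?p ?q" using legs_nonzero(1)[OF t] by (simp add: leg_x_def)
  ultimately show ?thesis by linarith
qed

lemma (in fem_grid) in_Linf_bdd_meas:
  assumes "in_Linf L f"
  shows "bdd_meas f"
proof -
  have "AE z in lebesgue_on (Omega L). ereal \<bar>f z\<bar> \<le> Linf_norm L f"
    unfolding Linf_norm_def by (rule esssup_AE)
  moreover obtain b where "Linf_norm L f \<le> ereal b"
    using assms unfolding in_Linf_def by (cases "Linf_norm L f") auto
  ultimately have "AE z in lebesgue_on (Omega L). \<bar>f z\<bar> \<le> b"
    by (auto elim!: eventually_mono dest: order_trans)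
  then show ?thesis using assms unfolding bdd_meas_def in_Linf_def by blast
qed

lemma (in fem_grid) norm1inf_bound:
  assumes p: "in_W1inf L p px py"
  shows "AE z in lebesgue_on (Omega L). \<bar>px z\<bar> \<le> norm1inf L p px py \<and> \<bar>py z\<bar> \<le> norm1inf L p px py"
    and "0 \<le> norm1inf L p px py"
proof -
  define E where "E = max (Linf_norm L p) (max (Linf_norm L px) (Linf_norm L py))"
  have fin: "E < \<infinity>" using p by (auto simp: in_W1inf_def in_Linf_def E_def max_def)
  \<comment> \<open>\<open>real_of_ereal\<close> sends \<infinity> to 0, hence the appeal to the
    finiteness of \<open>E\<close>.\<close>
  have le: "\<bar>x\<bar> \<le> real_of_ereal E" if "ereal \<bar>x\<bar> \<le> E" for x
    using that fin by (cases E) auto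
  have "AE z in lebesgue_on (Omega L). ereal \<bar>px z\<bar> \<le> Linf_norm L px"
    "AE z in lebesgue_on (Omega L). ereal \<bar>py z\<bar> \<le> Linf_norm L py"
    unfolding Linf_norm_def by (rule esssup_AE)+
  then have ae: "AE z in lebesgue_on (Omega L). \<bar>px z\<bar> \<le> real_of_ereal E \<and> \<bar>py z\<bar> \<le> real_of_ereal E"
  proof eventually_elim
    case (elim z)
    then have "ereal \<bar>px z\<bar> \<le> E" "ereal \<bar>py z\<bar> \<le> E" by (simp_all add: E_def le_max_iff_disj)
    then show ?case using le by blast
  qed
  then show "AE z in lebesgue_on (Omega L). \<bar>px z\<bar> \<le> norm1inf L p px py \<and> \<bar>py z\<bar> \<le> norm1inf L p px py"
    by (simp add: norm1inf_def E_def)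
  \<comment> \<open>A negative bound on absolute values would make the square a null set, but it is
    open and nonempty.\<close>
  have "0 \<le> real_of_ereal E"
  proof (rule ccontr)
    assume neg: "\<not> ?thesis"
    have "AE z in lebesgue. z \<notin> Omega L"
      using ae by (subst (asm) AE_restrict_space_iff) (use neg in \<open>auto elim!: eventually_mono\<close>)
    then have "negligible (Omega L)"
      unfolding negligible_iff_null_sets by (subst AE_iff_null_sets) simp_all
    moreover have "open (Omega L)" "(L / 2, L / 2) \<in> Omega L"
      using L_pos by (auto simp: Omega_def open_Times)
    ultimately show False using open_not_negligible by blast
  qed
  then show "0 \<le> norm1inf L p px py" by (simp add: norm1inf_def E_def)
qed

text \<open>Orthogonality is tested with the projection itself; Cauchy-Schwarz then lets one factor
  cancel.\<close>

lemma (in fem_space) L2_projection_bound: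
  assumes w: "in_L2 L w" and proj: "L2_projection L XNP w (fe \<phi> a)"
  shows "norm2 L (fe \<phi> a) \<le> norm2 L w"
proof -
  let ?I = "\<lambda>f. LINT z|lebesgue_on (Omega L). f z"
  let ?v = "fe \<phi> a"
  have bm: "bdd_meas ?v" by (intro bdd_meas_X_N fe_X_N)
  have i: "integrable (lebesgue_on (Omega L)) (\<lambda>z. (w z)\<^sup>2)" "integrable (lebesgue_on (Omega L)) (\<lambda>z. (?v z)\<^sup>2)"
    using w bm by (auto simp: in_L2_def intro: bdd_meas_integrable bdd_meas_power)
  have wv: "integrable (lebesgue_on (Omega L)) (\<lambda>z. w z * ?v z)"
    using w bm i by (intro L2_mult_integrable) (auto simp: in_L2_def bdd_meas_measurable)
  have "ip2 L (\<lambda>z. w z - ?v z) ?v = 0" using proj fe_X_NP by (simp add: L2_projection_def)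
  then have eq: "?I (\<lambda>z. w z * ?v z) = ?I (\<lambda>z. (?v z)\<^sup>2)"
    using wv i(2) by (simp add: ip2_def left_diff_distrib power2_eq_square)
  have "(?I (\<lambda>z. w z * ?v z))\<^sup>2 \<le> ?I (\<lambda>z. (w z)\<^sup>2) * ?I (\<lambda>z. (?v z)\<^sup>2)"
    using L2_Cauchy_Schwarz[of "lebesgue_on (Omega L)" w ?v] i wv by (simp add: power2_eq_square)
  then have "?I (\<lambda>z. (?v z)\<^sup>2) * ?I (\<lambda>z. (?v z)\<^sup>2) \<le> ?I (\<lambda>z. (w z)\<^sup>2) * ?I (\<lambda>z. (?v z)\<^sup>2)"
    unfolding eq by (simp add: power2_eq_square)
  moreover have "0 \<le> ?I (\<lambda>z. (?v z)\<^sup>2)" "0 \<le> ?I (\<lambda>z. (w z)\<^sup>2)" by simp_all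
  ultimately have "?I (\<lambda>z. (?v z)\<^sup>2) \<le> ?I (\<lambda>z. (w z)\<^sup>2)"
    by (cases "?I (\<lambda>z. (?v z)\<^sup>2) = 0") (auto simp: less_le)
  then show ?thesis by (simp add: norm2_def ip2_def power2_eq_square)
qed

text \<open>The product \<open>(1 - y) * (1 + 3 * y)\<close> equals
  \<open>1 + y * (2 - 3 * y)\<close>. With \<open>y = \<tau> * P\<close> this turns the growth
  factor \<open>1 / (1 - y)\<close> of a time step into \<open>exp (3 * y)\<close>.\<close>

lemma one_le_decay_exp:
  fixes y :: real
  assumes "0 \<le> y" "y \<le> 1 / 6"
  shows "1 \<le> (1 - y) * exp (3 * y)"
proof -
  have "1 \<le> (1 - y) * (1 + 3 * y)"
    using mult_left_mono[OF assms(2,1)] assms by (simp add: algebra_simps)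
  also have "\<dots> \<le> (1 - y) * exp (3 * y)"
    using assms by (intro mult_left_mono exp_ge_add_one_self) auto
  finally show ?thesis .
qed

lemma (in implicit_scheme) implicit_growth:
  assumes "\<And>j. j < m \<Longrightarrow> step (W j) (V j) (U j) (W (Suc j))"
  shows "j \<le> m \<Longrightarrow> nM (W j) \<le> exp (3 * (\<tau> * P) * real j) * nM (W 0)"
proof (induction j)
  case (Suc j)
  let ?y = "\<tau> * P"
  have y: "0 \<le> ?y" "?y \<le> 1 / 6" using tau_P tau_pos P_nonneg by auto
  have "nM (W (Suc j)) * 1 \<le> nM (W (Suc j)) * ((1 - ?y) * exp (3 * ?y))"
    by (intro mult_left_mono one_le_decay_exp y) simp
  also have "\<dots> = (1 - ?y) * nM (W (Suc j)) * exp (3 * ?y)" by simp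
  also have "\<dots> \<le> nM (W j) * exp (3 * ?y)"
    using Suc.prems by (intro mult_right_mono step_stable[OF assms]) auto
  also have "\<dots> \<le> (exp (3 * ?y * real j) * nM (W 0)) * exp (3 * ?y)"
    using Suc by (intro mult_right_mono) auto
  also have "\<dots> = exp (3 * ?y * real (Suc j)) * nM (W 0)"
    by (simp add: algebra_simps exp_add)
  finally show ?case by simp
qed simp

theorem theorem4p6:
  fixes L T \<tau> h c0inv cinv :: real
    and p px py u0 lap_u0 w0 :: "real \<times> real \<Rightarrow> real"
    and n m :: nat
    and xs ys :: "nat \<Rightarrow> real"
    and d :: "nat \<Rightarrow> nat \<Rightarrow> bool"
    and \<T> :: "(real \<times> real) set set"
    and node :: "'n::finite \<Rightarrow> nat \<times> nat"
    and \<phi> :: "'n \<Rightarrow> real \<times> real \<Rightarrow> real"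
    and U W :: "nat \<Rightarrow> real^'n"
  assumes "L > 0" and "T > 0"
    and "in_W1inf L p px py"
    and "in_H2 L u0" and "in_H1P L u0"
    and "weak_laplacian L u0 lap_u0"
    and "in_L2 L w0"
    and "AE z in lebesgue_on (Omega L). w0 z = u0 z - lap_u0 z"
    and "grid L n xs" and "grid L n ys"
    and "\<T> = triangles n xs ys d"
    and "h = mesh_size \<T>"
    and "nodal_basis L n xs ys d node \<phi>"
    and "c0inv > 0" and "\<forall>v \<in> X_N L \<T>. normH1 L v \<le> c0inv / h * norm2 L v"
    and "cinv > 0" and "\<forall>v \<in> X_N L \<T>. seminorm14 L v \<le> cinv * h powr (- 5 / 4) * norm2 L v"
    and "h < 1"
    and "0 < \<tau>"
    and "real m * \<tau> + \<tau> \<le> T"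
    and "implicit_solution L \<phi> (X_NP L \<T>) px py w0 \<tau> m U W"
    and "ereal \<tau> \<le> tau_bound h c0inv (norm1inf L p px py) (normM L \<phi> (W m))
            (D3 cinv T (norm1inf L p px py) (norm2 L w0))"
  shows "\<exists>U' W'.
     (\<forall>U'' W''. implicit_step L \<phi> px py \<tau> (U m) (W m) U'' W'' \<longleftrightarrow> U'' = U' \<and> W'' = W') \<and>
     (\<forall>Ui Wi. \<exists>Uk Wk. Uk 0 = Ui \<and> Wk 0 = Wi \<and> newton_iterates L \<phi> px py \<tau> (W m) Uk Wk) \<and>
     (\<forall>Uk Wk. newton_iterates L \<phi> px py \<tau> (W m) Uk Wk \<longrightarrow>
        Uk \<longlonglongrightarrow> U' \<and> Wk \<longlonglongrightarrow> W' \<and>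
        (\<lambda>k. norm2 L (\<lambda>z. fe \<phi> (Uk k) z - fe \<phi> U' z)) \<longlonglongrightarrow> 0 \<and>
        (\<lambda>k. norm2 L (\<lambda>z. fe \<phi> (Wk k) z - fe \<phi> W' z)) \<longlonglongrightarrow> 0)"
proof -
  interpret fem_space L n xs ys d node \<phi>
    using assms by unfold_locales auto
  define P where "P = norm1inf L p px py"
  define B where "B = exp (3 * T * P) * norm2 L w0"
  define D where "D = D3 cinv T P (norm2 L w0)"
  \<comment> \<open>The Hoelder bound contains two gradients, each estimated by the inverse
    inequality; hence the square.\<close>
  define \<beta> where "\<beta> = (cinv * h powr (- 5 / 4))\<^sup>2"
  let ?gr = "\<lambda>a. sqrt (energy a)"
  have h: "0 < h" using mesh_size_pos assms by simp
  have P: "0 \<le> P" "AE z in lebesgue_on (Omega L). \<bar>px z\<bar> \<le> P \<and> \<bar>py z\<bar> \<le> P"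
    using norm1inf_bound assms by (auto simp: P_def)
  have bm: "bdd_meas px" "bdd_meas py"
    using assms by (auto simp: in_W1inf_def intro: in_Linf_bdd_meas)
  have w0: "0 \<le> norm2 L w0" by (simp add: norm2_def ip2_def)
  have B: "0 \<le> B" using w0 by (simp add: B_def)
  have D: "D = cinv\<^sup>2 * B + 2 * P" by (simp add: D_def D3_def B_def)
  have D_nonneg: "0 \<le> D" using B P by (simp add: D)

  have tau_le: "ereal \<tau> \<le> 1 / ereal (6 * P)" "ereal \<tau> \<le> ereal (h powr (5 / 2)) / ereal D"
    using assms by (auto simp: tau_bound_def P_def D_def)
  \<comment> \<open>For \<open>P = 0\<close> the extended quotient is \<infinity> and the claim is
    trivial.\<close>
  have tau_P: "6 * \<tau> * P \<le> 1"
    using tau_le(1) P by (cases "P = 0") (auto simp: one_ereal_def field_simps)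
  have tau_D: "\<tau> * D \<le> h powr (5 / 2)"
    using tau_le(2) D_nonneg by (cases "D = 0") (auto simp: field_simps)
  \<comment> \<open>As \<open>h < 1\<close>, the term \<open>2 * P\<close> may be enlarged by
    \<open>h powr (- 5 / 2)\<close>, the factor that the inverse inequality attaches to
    \<open>B\<close>. The sum becomes \<open>h powr (- 5 / 2) * D\<close>, which the bound on
    \<open>\<tau>\<close> balances.\<close>
  have tau_B: "\<tau> * (\<beta> * B + 2 * P) \<le> 1"
  proof -
    have hb: "1 \<le> h powr (- 5 / 2)"
      using h \<open>h < 1\<close> powr_mono'[of "- 5 / 2" 0 h] by simp
    have "(h powr (- 5 / 4))\<^sup>2 = h powr (- 5 / 2)" using h by (simp add: powr_power)
    then have "\<beta> * B + 2 * P \<le> h powr (- 5 / 2) * (cinv\<^sup>2 * B) + h powr (- 5 / 2) * (2 * P)"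
      using mult_right_mono[OF hb, of "2 * P"] P by (simp add: \<beta>_def power_mult_distrib mult_ac)
    then have "\<tau> * (\<beta> * B + 2 * P) \<le> \<tau> * (h powr (- 5 / 2) * D)"
      using \<open>0 < \<tau>\<close> by (intro mult_left_mono) (auto simp: D algebra_simps)
    also have "\<dots> = h powr (- 5 / 2) * (\<tau> * D)" by simp
    also have "\<dots> \<le> h powr (- 5 / 2) * h powr (5 / 2)" using tau_D by (intro mult_left_mono) auto
    also have "\<dots> = 1" using h by (simp flip: powr_add)
    finally show ?thesis .
  qed

  have normM: "sqrt (a \<bullet> (matM L \<phi> *v a)) = norm2 L (fe \<phi> a)" for a
    by (simp add: matM_form norm2_def)
  interpret scheme: implicit_scheme "matM L \<phi>" "matK L \<phi>" "matR L \<phi> px py" "matS L \<phi>" ?gr \<tau> P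
  proof
    show "a \<bullet> (matM L \<phi> *v b) = b \<bullet> (matM L \<phi> *v a)" for a b
      by (simp add: matM_form ip2_def mult.commute)
    show "a \<bullet> (matS L \<phi> u *v a) = 0" for u a
      using advection_skew[OF fe_X_NP fe_X_NP] by (simp add: matS_form)
    show "\<bar>a \<bullet> (matR L \<phi> px py *v u)\<bar> \<le> 2 * P * ?gr u * sqrt (a \<bullet> (matM L \<phi> *v a))" for u a
      using transport_bound[OF fe_X_N fe_X_N bm P(2,1)] by (simp add: matR_form[OF bm] energy_def normM)
  qed (use P tau_P \<open>0 < \<tau>\<close> in \<open>simp_all add: matM_pos energy_nonneg matK_form matS_diff\<close>)

  have step_iff: "scheme.step (W j) V V' W' \<longleftrightarrow>
      (matM L \<phi> + \<tau> *\<^sub>R matS L \<phi> V) *v W' - \<tau> *\<^sub>R (matR L \<phi> px py *v V') = matM L \<phi> *v W j \<and>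
      matK L \<phi> *v V' = matM L \<phi> *v W'" for j V V' W'
    unfolding scheme.step_def by (simp add: matrix_vector_mult_add_rdistrib scaleR_matrix_vector_assoc)
  have sol: "L2_projection L XNP w0 (fe \<phi> (W 0))" "matK L \<phi> *v U 0 = matM L \<phi> *v W 0"
      "\<And>j. j < m \<Longrightarrow> implicit_step L \<phi> px py \<tau> (U j) (W j) (U (Suc j)) (W (Suc j))"
    using assms by (auto simp: implicit_solution_def)
  \<comment> \<open>From the initial condition if \<open>m = 0\<close>, otherwise from the step that
    ends at index \<open>m\<close>.\<close>
  have KU: "matK L \<phi> *v U m = matM L \<phi> *v W m"
    using sol(2) sol(3)[of "m - 1"] by (cases m) (auto simp: implicit_step_def)

  have "scheme.nM (W m) \<le> exp (3 * (\<tau> * P) * real m) * scheme.nM (W 0)"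
  proof (rule scheme.implicit_growth[of m W "\<lambda>j. U (Suc j)" "\<lambda>j. U (Suc j)"])
    show "scheme.step (W j) (U (Suc j)) (U (Suc j)) (W (Suc j))" if "j < m" for j
      using sol(3)[OF that] by (simp add: step_iff implicit_step_def)
  qed simp
  also have "\<dots> \<le> exp (3 * (\<tau> * P) * real m) * norm2 L w0"
    using L2_projection_bound[OF \<open>in_L2 L w0\<close> sol(1)]
    by (intro mult_left_mono) (simp_all add: scheme.nM_def normM)
  finally have Wm: "scheme.nM (W m) \<le> exp (3 * (\<tau> * P) * real m) * norm2 L w0" .
  \<comment> \<open>The \<open>m\<close> steps taken so far use \<open>m\<close> factors
    \<open>exp (3 * (\<tau> * P))\<close>. One more such factor pays for
    \<open>1 - \<tau> * P\<close>, and \<open>m + 1\<close> of them are within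
    \<open>exp (3 * T * P)\<close> because the next time level does not exceed
    \<open>T\<close>.\<close>
  have Wt_bound: "scheme.nM (W m) \<le> (1 - \<tau> * P) * B"
  proof -
    have y: "0 \<le> \<tau> * P" "\<tau> * P \<le> 1 / 6" using P \<open>0 < \<tau>\<close> tau_P by auto
    have "exp (3 * (\<tau> * P) * real m) * norm2 L w0 * 1 \<le>
        exp (3 * (\<tau> * P) * real m) * norm2 L w0 * ((1 - \<tau> * P) * exp (3 * (\<tau> * P)))"
      using w0 by (intro mult_left_mono one_le_decay_exp y) simp
    also have "\<dots> = (1 - \<tau> * P) * (exp (3 * (real m * \<tau> + \<tau>) * P) * norm2 L w0)"
      by (simp add: algebra_simps exp_add)
    also have "\<dots> \<le> (1 - \<tau> * P) * B"
      unfolding B_def using assms(20) P w0 y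
      by (intro mult_left_mono mult_right_mono iffD2[OF exp_le_cancel_iff]) auto
    finally show ?thesis using Wm by simp
  qed

  obtain C where C: "0 \<le> C" "\<And>a w. (LINT z|lebesgue_on (Omega L). (grad (fe \<phi> a) z \<bullet> grad (fe \<phi> a) z) * (fe \<phi> w z)\<^sup>2)
      \<le> C * (norm a)\<^sup>2 * (norm w)\<^sup>2"
    using grad_fe_bound by blast
  interpret newton: newton_scheme "matM L \<phi>" "matK L \<phi>" "matR L \<phi> px py" "matS L \<phi>" ?gr \<tau> P B \<beta> "sqrt C" "W m"
  proof
    fix u a w
    have semi: "seminorm14 L (fe \<phi> v) \<le> cinv * h powr (- 5 / 4) * norm2 L (fe \<phi> v)" for v
      using assms fe_X_N by blast
    have "\<bar>a \<bullet> (matS L \<phi> u *v w)\<bar> \<le> seminorm14 L (fe \<phi> u) * seminorm14 L (fe \<phi> a) * norm2 L (fe \<phi> w)"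
      using advection_Hoelder[OF fe_X_N fe_X_N fe_X_N] by (simp add: matS_form)
    also have "\<dots> \<le> (cinv * h powr (- 5 / 4) * norm2 L (fe \<phi> u)) * (cinv * h powr (- 5 / 4) * norm2 L (fe \<phi> a)) * norm2 L (fe \<phi> w)"
      using \<open>cinv > 0\<close>
      by (intro mult_right_mono mult_mono semi) (simp_all add: seminorm14_def norm2_def ip2_def)
    finally show "\<bar>a \<bullet> (matS L \<phi> u *v w)\<bar> \<le> \<beta> * sqrt (u \<bullet> (matM L \<phi> *v u)) * sqrt (a \<bullet> (matM L \<phi> *v a)) *
        sqrt (w \<bullet> (matM L \<phi> *v w))"
      by (simp add: normM \<beta>_def power2_eq_square mult_ac)
    have "(a \<bullet> (matS L \<phi> u *v w))\<^sup>2 \<le> energy u * (LINT z|lebesgue_on (Omega L). (grad (fe \<phi> a) z \<bullet> grad (fe \<phi> a) z) * (fe \<phi> w z)\<^sup>2)"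
      using advection_weighted_bound[OF fe_X_N fe_X_N fe_X_N] by (simp add: matS_form energy_def)
    also have "\<dots> \<le> energy u * (C * (norm a)\<^sup>2 * (norm w)\<^sup>2)"
      by (intro mult_left_mono C energy_nonneg)
    also have "\<dots> = (sqrt C * ?gr u * norm a * norm w)\<^sup>2"
      using C(1) energy_nonneg[of u] by (simp add: power_mult_distrib mult_ac)
    finally show "\<bar>a \<bullet> (matS L \<phi> u *v w)\<bar> \<le> sqrt C * ?gr u * norm a * norm w"
      by (intro power2_le_imp_le[of "\<bar>_\<bar>"]) (use C(1) energy_nonneg[of u] in auto)
  qed (use C tau_B Wt_bound in \<open>simp_all add: \<beta>_def scheme.nM_def\<close>)

  obtain U' W' where UW: "scheme.step (W m) U' U' W'" using newton.implicit_step_ex by blast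
  \<comment> \<open>\<open>KU\<close> supplies the clause about the old stream, so an implicit step
    is a frozen step whose old and new streams agree.\<close>
  have implicit: "implicit_step L \<phi> px py \<tau> (U m) (W m) X Y \<longleftrightarrow> scheme.step (W m) X X Y" for X Y
    using KU by (auto simp: implicit_step_def step_iff)
  have newton: "newton_iterates L \<phi> px py \<tau> (W m) Uk Wk \<longleftrightarrow>
      (\<forall>k. scheme.step (W m) (Uk k) (Uk (Suc k)) (Wk (Suc k)))" for Uk Wk
    unfolding newton_iterates_def step_iff by (simp add: add.commute)
  have lim: "(\<lambda>k. norm2 L (\<lambda>z. fe \<phi> (Xk k) z - fe \<phi> X z)) \<longlonglongrightarrow> 0" if "Xk \<longlonglongrightarrow> X" for Xk X
  proof -
    have "(\<lambda>k. scheme.nM (Xk k - X)) \<longlonglongrightarrow> scheme.nM 0"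
      using scheme.continuous_nM[of UNIV] that
      by (intro isCont_tendsto_compose[where g = scheme.nM])
        (auto simp: continuous_on_eq_continuous_at LIM_zero_iff)
    moreover have "scheme.nM (Xk k - X) = norm2 L (\<lambda>z. fe \<phi> (Xk k) z - fe \<phi> X z)" for k
      by (simp add: scheme.nM_def normM fe_diff[abs_def])
    ultimately show ?thesis by simp
  qed
  show ?thesis
  proof (rule exI[of _ U'], rule exI[of _ W'], intro conjI allI impI)
    show "implicit_step L \<phi> px py \<tau> (U m) (W m) X Y \<longleftrightarrow> X = U' \<and> Y = W'" for X Y
      unfolding implicit using UW newton.implicit_step_unique[OF UW] by blast
    show "\<exists>Uk Wk. Uk 0 = Ui \<and> Wk 0 = Wi \<and> newton_iterates L \<phi> px py \<tau> (W m) Uk Wk" for Ui Wi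
      unfolding newton using newton.newton_sequence_ex[of Ui Wi] by metis
    fix Uk Wk assume "newton_iterates L \<phi> px py \<tau> (W m) Uk Wk"
    then have it: "\<And>k. scheme.step (W m) (Uk k) (Uk (Suc k)) (Wk (Suc k))" by (simp add: newton)
    note conv = newton.newton_converges[OF UW, of Uk Wk, OF it]
    show "Uk \<longlonglongrightarrow> U'" "Wk \<longlonglongrightarrow> W'" by (rule conv(1), rule conv(2))
    show "(\<lambda>k. norm2 L (\<lambda>z. fe \<phi> (Uk k) z - fe \<phi> U' z)) \<longlonglongrightarrow> 0"
      "(\<lambda>k. norm2 L (\<lambda>z. fe \<phi> (Wk k) z - fe \<phi> W' z)) \<longlonglongrightarrow> 0"
      by (rule lim[OF conv(1)], rule lim[OF conv(2)])
  qed
qed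

end
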